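(* Let $M$ be a compact manifold with a volume form $\omega$, let $f:M\to M$ be a $\mathcal{C}^1$-diffeomorphism preserving $\omega$, and let $p\in M$ be a hyperbolic periodic point of $f$. If $W^u(p,f)$ contains a recurrent point of $f$ and there is no homoclinic point of $p$, then $f$ is nonshadowable.
   Context: $M$ is an $n$-dimensional differentiable manifold with a metric $d$ inducing its topology. A volume form is a nowhere vanishing $n$-form; $f$ preserves $\omega$ if $f^*\omega=\omega$. A periodic point $p$ of period $k$ is hyperbolic if all ($n$, counted with multiplicity) eigenvalues of $D(f^k)_p:T_pM\to T_pM$ have absolute value different from $1$. Stable and unstable manifolds: $W^s(p,f)=\{u\in M: d(f^n(u),f^n(p))\to 0 \text{ as } n\to\infty\}$ and $W^u(p,f)=\{u\in M: d(f^{-n}(u),f^{-n}(p))\to 0\text{ as } n\to\infty\}$. A homoclinic point of $p$ is a point $q\in W^s(p,f)\cap W^u(p,f)$ with $q\ne p$. A point $q$ is (positively) recurrent if $q\in\omega(q,f)$, where $\omega(q,f)$ is the set of limits $\lim_{j\to\infty} f^{n_j}(q)$ over integer sequences $n_j\to\infty$. A $\delta$-pseudo-orbit of $f$ is a sequence $(x_i)_{i\in\mathbb{Z}}$ in $M$ with $d(x_{i+1},f(x_i))<\delta$ for all $i\in\mathbb{Z}$; it is $\epsilon$-shadowed by the orbit of $x\in M$ if $d(x_i,f^i(x))<\epsilon$ for all $i\in\mathbb{Z}$. The diffeomorphism $f$ is nonshadowable if there is some $\epsilon>0$ such that for every $\delta>0$ there is a $\delta$-pseudo-orbit which is not $\epsilon$-shadowed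 by any orbit of $f$ in $M$. *)

theory Defs
  imports "HOL-Analysis.Analysis" "HOL-Library.Extended_Nat"
begin

section \<open>Maps of class \<open>C\<^sup>r\<close> on open subsets of a Euclidean space\<close>

text \<open>Only meaningful for open \<open>S\<close>. In finite dimension, continuity of all directional
  derivatives is the same as continuity of the derivative in the operator norm.\<close>

primrec Ck_on :: "nat \<Rightarrow> 'a::euclidean_space set \<Rightarrow> ('a \<Rightarrow> 'b::real_normed_vector) \<Rightarrow> bool" where
  "Ck_on 0 S g \<longleftrightarrow> continuous_on S g"
| "Ck_on (Suc k) S g \<longleftrightarrow>
     (\<forall>x\<in>S. g differentiable (at x)) \<and>
     (\<forall>v. Ck_on k S (\<lambda>x. frechet_derivative g (at x) v))"

definition Cr_on :: "enat \<Rightarrow> 'a::euclidean_space set \<Rightarrow> ('a \<Rightarrow> 'b::real_normed_vector) \<Rightarrow> bool" where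
  "Cr_on r S g \<longleftrightarrow> (\<forall>k. enat k \<le> r \<longrightarrow> Ck_on k S g)"


section \<open>Manifolds\<close>

text \<open>The manifold is the whole type \<open>'m\<close>, its metric is \<^const>\<open>dist\<close>, and it is modelled on the
  Euclidean space \<open>'e\<close>, so its dimension is \<open>DIM('e)\<close>, which is positive. A chart is a pair
  of its domain and its coordinate map; the values of the latter outside the domain are irrelevant.\<close>

type_synonym ('m, 'e) chart = "'m set \<times> ('m \<Rightarrow> 'e)"

definition chart_inv :: "('m, 'e) chart \<Rightarrow> 'e \<Rightarrow> 'm" where
  "chart_inv c = inv_into (fst c) (snd c)"

definition is_chart :: "('m::metric_space, 'e::euclidean_space) chart \<Rightarrow> bool" where
  "is_chart c \<longleftrightarrow> open (fst c) \<and> open (snd c ` fst c) \<and>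
     homeomorphism (fst c) (snd c ` fst c) (snd c) (chart_inv c)"

definition transition :: "('m, 'e) chart \<Rightarrow> ('m, 'e) chart \<Rightarrow> 'e \<Rightarrow> 'e" where
  "transition c c' = snd c' \<circ> chart_inv c"

definition Cr_atlas :: "enat \<Rightarrow> ('m::metric_space, 'e::euclidean_space) chart set \<Rightarrow> bool" where
  "Cr_atlas r A \<longleftrightarrow>
     (\<forall>c\<in>A. is_chart c) \<and> (\<Union>c\<in>A. fst c) = UNIV \<and>
     (\<forall>c\<in>A. \<forall>c'\<in>A. Cr_on r (snd c ` (fst c \<inter> fst c')) (transition c c'))"

definition charts_at :: "('m, 'e) chart set \<Rightarrow> 'm \<Rightarrow> ('m, 'e) chart set" where
  "charts_at A x = {c \<in> A. x \<in> fst c}"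

definition C1_map :: "('m::metric_space, 'e::euclidean_space) chart set \<Rightarrow> ('m \<Rightarrow> 'm) \<Rightarrow> bool" where
  "C1_map A f \<longleftrightarrow> continuous_on UNIV f \<and>
     (\<forall>c\<in>A. \<forall>c'\<in>A.
        Cr_on 1 (snd c ` (fst c \<inter> f -` fst c')) (snd c' \<circ> f \<circ> chart_inv c))"

definition C1_diffeomorphism ::
    "('m::metric_space, 'e::euclidean_space) chart set \<Rightarrow> ('m \<Rightarrow> 'm) \<Rightarrow> bool" where
  "C1_diffeomorphism A f \<longleftrightarrow> bij f \<and> C1_map A f \<and> C1_map A (inv f)"


section \<open>Tangent spaces and differentials\<close>

text \<open>A tangent vector at \<open>x\<close> is the family of its coordinate vectors in all charts around \<open>x\<close>,
  these being related by the derivatives of the transition maps. The value at charts not around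
  \<open>x\<close> is fixed to be zero. The vector space operations are pointwise.\<close>

type_synonym ('m, 'e) tangent = "('m, 'e) chart \<Rightarrow> 'e"

definition tangent_space ::
    "('m::metric_space, 'e::euclidean_space) chart set \<Rightarrow> 'm \<Rightarrow> ('m, 'e) tangent set" where
  "tangent_space A x =
     {v. (\<forall>c\<in>charts_at A x. \<forall>c'\<in>charts_at A x.
            v c' = frechet_derivative (transition c c') (at (snd c x)) (v c)) \<and>
         (\<forall>c. c \<notin> charts_at A x \<longrightarrow> v c = 0)}"

text \<open>The tangent vector at \<open>x\<close> with coordinates \<open>b\<close> in the chart \<open>c\<close>.\<close>

definition coord_vector :: "('m::metric_space, 'e::euclidean_space) chart set \<Rightarrow>
    ('m, 'e) chart \<Rightarrow> 'm \<Rightarrow> 'e \<Rightarrow> ('m, 'e) tangent" where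
  "coord_vector A c x b =
     (\<lambda>c'. if c' \<in> charts_at A x
           then frechet_derivative (transition c c') (at (snd c x)) b else 0)"

text \<open>By the chain rule, the choice of the chart around \<open>x\<close> is immaterial.\<close>

definition differential :: "('m::metric_space, 'e::euclidean_space) chart set \<Rightarrow>
    ('m \<Rightarrow> 'm) \<Rightarrow> 'm \<Rightarrow> ('m, 'e) tangent \<Rightarrow> ('m, 'e) tangent" where
  "differential A f x v =
     (let c = (SOME c. c \<in> charts_at A x) in
      (\<lambda>c'. if c' \<in> charts_at A (f x)
            then frechet_derivative (snd c' \<circ> f \<circ> chart_inv c) (at (snd c x)) (v c) else 0))"


section \<open>Volume forms\<close>

definition alternating_on ::
    "('m::metric_space, 'e::euclidean_space) chart set \<Rightarrow> 'm \<Rightarrow> (('m, 'e) tangent list \<Rightarrow> real) \<Rightarrow> bool"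
  where
  "alternating_on A x \<alpha> \<longleftrightarrow>
     (\<forall>vs. length vs = DIM('e) \<and> set vs \<subseteq> tangent_space A x \<longrightarrow>
        (\<forall>i<DIM('e). \<forall>u\<in>tangent_space A x. \<forall>w\<in>tangent_space A x. \<forall>a b.
           \<alpha> (vs[i := (\<lambda>c. a *\<^sub>R u c + b *\<^sub>R w c)]) = a * \<alpha> (vs[i := u]) + b * \<alpha> (vs[i := w])) \<and>
        (\<not> distinct vs \<longrightarrow> \<alpha> vs = 0))"

text \<open>On a manifold of class \<open>C\<^sup>r\<close> the tangent bundle, and hence its forms, are only of class
  \<open>C\<^sup>r\<^sup>-\<^sup>1\<close>; note that \<open>\<infinity> - 1 = \<infinity>\<close>. The class of the form is read off from its values on the
  constant coordinate vector fields of the charts.\<close>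

definition volume_form :: "enat \<Rightarrow> ('m::metric_space, 'e::euclidean_space) chart set \<Rightarrow>
    ('m \<Rightarrow> ('m, 'e) tangent list \<Rightarrow> real) \<Rightarrow> bool" where
  "volume_form r A \<omega> \<longleftrightarrow>
     (\<forall>x. alternating_on A x (\<omega> x)) \<and>
     (\<forall>c\<in>A. \<forall>bs. length bs = DIM('e) \<longrightarrow>
        Cr_on (r - 1) (snd c ` fst c)
          (\<lambda>y. \<omega> (chart_inv c y) (map (coord_vector A c (chart_inv c y)) bs))) \<and>
     (\<forall>x. \<exists>vs. length vs = DIM('e) \<and> set vs \<subseteq> tangent_space A x \<and> \<omega> x vs \<noteq> 0)"

definition preserves_form :: "('m::metric_space, 'e::euclidean_space) chart set \<Rightarrow>
    ('m \<Rightarrow> 'm) \<Rightarrow> ('m \<Rightarrow> ('m, 'e) tangent list \<Rightarrow> real) \<Rightarrow> bool" where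
  "preserves_form A f \<omega> \<longleftrightarrow>
     (\<forall>x vs. length vs = DIM('e) \<and> set vs \<subseteq> tangent_space A x \<longrightarrow>
        \<omega> (f x) (map (differential A f x) vs) = \<omega> x vs)"


section \<open>Hyperbolic periodic points\<close>

text \<open>The eigenvalues of a real endomorphism, counted as \<open>n\<close> with multiplicity, are the complex
  ones: \<open>z\<close> is an eigenvalue of the complexification of \<open>T\<close> iff \<open>T u + \<i> T w = z (u + \<i> w)\<close> for some
  nonzero \<open>u + \<i> w\<close>; the two equations below are the real and imaginary parts.\<close>

definition complex_eigenvalue ::
    "('c \<Rightarrow> 'e::real_vector) set \<Rightarrow> (('c \<Rightarrow> 'e) \<Rightarrow> ('c \<Rightarrow> 'e)) \<Rightarrow> complex \<Rightarrow> bool" where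
  "complex_eigenvalue V T z \<longleftrightarrow>
     (\<exists>u\<in>V. \<exists>w\<in>V. (u \<noteq> (\<lambda>_. 0) \<or> w \<noteq> (\<lambda>_. 0)) \<and>
        T u = (\<lambda>c. Re z *\<^sub>R u c - Im z *\<^sub>R w c) \<and>
        T w = (\<lambda>c. Im z *\<^sub>R u c + Re z *\<^sub>R w c))"

definition has_period :: "('m \<Rightarrow> 'm) \<Rightarrow> 'm \<Rightarrow> nat \<Rightarrow> bool" where
  "has_period f p k \<longleftrightarrow> 0 < k \<and> (f ^^ k) p = p \<and> (\<forall>j. 0 < j \<and> j < k \<longrightarrow> (f ^^ j) p \<noteq> p)"

definition hyperbolic_periodic_point ::
    "('m::metric_space, 'e::euclidean_space) chart set \<Rightarrow> ('m \<Rightarrow> 'm) \<Rightarrow> 'm \<Rightarrow> bool" where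
  "hyperbolic_periodic_point A f p \<longleftrightarrow>
     (\<exists>k. has_period f p k \<and>
        (\<forall>z. complex_eigenvalue (tangent_space A p) (differential A (f ^^ k) p) z \<longrightarrow> cmod z \<noteq> 1))"


section \<open>Dynamics of a bijection of a metric space\<close>

definition iterate :: "('m \<Rightarrow> 'm) \<Rightarrow> int \<Rightarrow> 'm \<Rightarrow> 'm" where
  "iterate f i = (if 0 \<le> i then f ^^ nat i else inv f ^^ nat (- i))"

definition stable_manifold :: "'m::metric_space \<Rightarrow> ('m \<Rightarrow> 'm) \<Rightarrow> 'm set" where
  "stable_manifold p f =
     {u. (\<lambda>n. dist (iterate f (int n) u) (iterate f (int n) p)) \<longlonglongrightarrow> 0}"

definition unstable_manifold :: "'m::metric_space \<Rightarrow> ('m \<Rightarrow> 'm) \<Rightarrow> 'm set" where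
  "unstable_manifold p f =
     {u. (\<lambda>n. dist (iterate f (- int n) u) (iterate f (- int n) p)) \<longlonglongrightarrow> 0}"

definition homoclinic_point :: "'m::metric_space \<Rightarrow> ('m \<Rightarrow> 'm) \<Rightarrow> 'm \<Rightarrow> bool" where
  "homoclinic_point p f q \<longleftrightarrow> q \<in> stable_manifold p f \<inter> unstable_manifold p f \<and> q \<noteq> p"

definition omega_limit_set :: "'m::metric_space \<Rightarrow> ('m \<Rightarrow> 'm) \<Rightarrow> 'm set" where
  "omega_limit_set q f =
     {y. \<exists>\<nu> :: nat \<Rightarrow> int. filterlim \<nu> at_top sequentially \<and> (\<lambda>j. iterate f (\<nu> j) q) \<longlonglongrightarrow> y}"

definition recurrent :: "('m::metric_space \<Rightarrow> 'm) \<Rightarrow> 'm \<Rightarrow> bool" where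
  "recurrent f q \<longleftrightarrow> q \<in> omega_limit_set q f"

definition pseudo_orbit :: "real \<Rightarrow> ('m::metric_space \<Rightarrow> 'm) \<Rightarrow> (int \<Rightarrow> 'm) \<Rightarrow> bool" where
  "pseudo_orbit \<delta> f x \<longleftrightarrow> (\<forall>i. dist (x (i + 1)) (f (x i)) < \<delta>)"

definition shadowed :: "real \<Rightarrow> ('m::metric_space \<Rightarrow> 'm) \<Rightarrow> (int \<Rightarrow> 'm) \<Rightarrow> 'm \<Rightarrow> bool" where
  "shadowed \<epsilon> f x y \<longleftrightarrow> (\<forall>i. dist (x i) (iterate f i y) < \<epsilon>)"

definition nonshadowable :: "('m::metric_space \<Rightarrow> 'm) \<Rightarrow> bool" where
  "nonshadowable f \<longleftrightarrow>
     (\<exists>\<epsilon>>0. \<forall>\<delta>>0. \<exists>x. pseudo_orbit \<delta> f x \<and> \<not> (\<exists>y. shadowed \<epsilon> f x y))"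

end

theory Submission
  imports Defs "HOL-Computational_Algebra.Fundamental_Theorem_Algebra"
begin

text \<open>
The orbit of \<open>p\<close> is an isolated invariant set: an orbit that stays near it for all times is that orbit
itself (\<open>hyperbolic_imp_isolated\<close>). In the linear approximation this says that a linear map without
eigenvalues on the unit circle has no bounded two-sided orbit but \<open>0\<close>, and by compactness the
expansion in one of the two time directions is uniform, so it survives a nonlinear error term.
Compactness turns isolation into asymptotic information: an orbit which stays near that of \<open>p\<close> in the
future lies on the stable manifold, and one which stays near it in the past on the unstable manifold
(\<open>tendsto_of_isolated\<close>).

The volume provides recurrence. The powers of \<open>f\<close> have Jacobian determinants that are quotients of
the density of \<open>\<omega>\<close> at two points, so they distort volume in charts by bounded factors, and an open set
whose iterates never meet it would have infinitely many disjoint preimages of comparable volume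
(\<open>no_wandering_open_set\<close>).

Recurrence excludes that \<open>p\<close> is Lyapunov stable, since a stable isolated fixed point attracts its
neighbours. Hence there are orbits that start arbitrarily close to \<open>p\<close> and leave a fixed ball, and a limit of
exit points is a point \<open>q \<noteq> p\<close> of the unstable manifold. Recurrence near a preimage of \<open>q\<close> then closes
the backward orbit of \<open>q\<close> up to a pseudo-orbit that leads, with two arbitrarily small jumps, from \<open>p\<close> past \<open>q\<close>
back to \<open>p\<close>. A point shadowing it would be homoclinic
(\<open>nonshadowable_if_isolated_recurrent_saddle\<close>), and there is none.
\<close>

section \<open>Orbits near an isolated fixed point of a homeomorphism\<close>

lemma iterate_succ:
  assumes "bij f"
  shows "iterate f (i + 1) x = f (iterate f i x)"
proof (cases "0 \<le> i")
  case True
  then show ?thesis by (simp add: iterate_def nat_add_distrib)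
next
  case False
  then obtain n where n: "i = - 1 - int n"
    by (intro that[of "nat (- 1 - i)"]) auto
  have 1: "nat (- i) = Suc n" using n by simp
  have "i + 1 = - int n" using n by simp
  then have "iterate f (i + 1) x = (inv f ^^ n) x"
    by (cases "n = 0") (auto simp: iterate_def)
  moreover have "f (iterate f i x) = f (inv f ((inv f ^^ n) x))"
    using False 1 by (simp add: iterate_def)
  ultimately show ?thesis
    using assms by (simp add: bij_is_surj surj_f_inv_f)
qed

lemma iterate_pred:
  assumes "bij f"
  shows "iterate f (i - 1) x = inv f (iterate f i x)"
  using iterate_succ[OF assms, of "i - 1" x] assms
  by (simp add: bij_is_inj inv_f_f)

lemma iterate_add:
  assumes "bij f"
  shows "iterate f (i + j) x = iterate f i (iterate f j x)"
proof (induction i rule: int_induct[where k = 0])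
  case base
  show ?case by (simp add: iterate_def)
next
  case (step1 i)
  have "iterate f (i + 1 + j) x = iterate f ((i + j) + 1) x" by (simp add: algebra_simps)
  then show ?case using step1 by (simp only: iterate_succ[OF assms])
next
  case (step2 i)
  have "iterate f (i - 1 + j) x = iterate f ((i + j) - 1) x" by (simp add: algebra_simps)
  then show ?case using step2 by (simp only: iterate_pred[OF assms])
qed

lemma iterate_of_nat: "iterate f (int n) = f ^^ n"
  by (simp add: iterate_def)

lemma iterate_minus_of_nat: "iterate f (- int n) = inv f ^^ n"
  by (cases "n = 0") (auto simp: iterate_def)

lemma continuous_on_funpow:
  assumes "continuous_on UNIV (g :: 'a::topological_space \<Rightarrow> 'a)"
  shows "continuous_on UNIV (g ^^ n)"
  by (induction n) (auto intro!: continuous_on_compose2[OF assms])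

lemma isCont_funpow:
  assumes "continuous_on UNIV (g :: 'a::t2_space \<Rightarrow> 'a)"
  shows "isCont (g ^^ n) x"
  using continuous_on_funpow[OF assms, of n] by (simp add: continuous_on_eq_continuous_at)

lemma funpow_inv_cancel:
  assumes "bij g" "m \<le> n"
  shows "(inv g ^^ m) ((g ^^ n) x) = (g ^^ (n - m)) x"
proof -
  have "(inv g ^^ m) ((g ^^ n) x) = iterate g (- int m) (iterate g (int n) x)"
    by (simp only: iterate_of_nat iterate_minus_of_nat)
  also have "\<dots> = iterate g (int (n - m)) x"
    using assms(2) by (simp add: iterate_add[OF assms(1), symmetric])
  finally show ?thesis by (simp only: iterate_of_nat)
qed

text \<open>Every accumulation point of a forward orbit that stays near \<open>p\<close> has its whole two-sided orbit near \<open>p\<close>, and hence equals \<open>p\<close>.\<close>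

lemma tendsto_of_isolated:
  fixes g :: "'m::metric_space \<Rightarrow> 'm"
  assumes M: "compact (UNIV :: 'm set)" and g: "bij g" "continuous_on UNIV g" "continuous_on UNIV (inv g)"
    and iso: "\<And>y. (\<And>n. dist ((g ^^ n) y) p \<le> e) \<Longrightarrow> (\<And>n. dist ((inv g ^^ n) y) p \<le> e) \<Longrightarrow> y = p"
    and y: "\<And>n. dist ((g ^^ n) y) p \<le> e"
  shows "(\<lambda>n. (g ^^ n) y) \<longlonglongrightarrow> p"
proof (rule ccontr)
  assume "\<not> ?thesis"
  then obtain \<eta> where \<eta>: "\<eta> > 0" and "\<not> (\<forall>\<^sub>F n in sequentially. dist ((g ^^ n) y) p < \<eta>)"
    unfolding tendsto_iff by blast
  then have "infinite {n. dist ((g ^^ n) y) p \<ge> \<eta>}"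
    by (simp add: eventually_sequentially infinite_nat_iff_unbounded_le not_less)
  from infinite_enumerate[OF this] obtain r :: "nat \<Rightarrow> nat" where "strict_mono r" "\<forall>n. r n \<in> {n. dist ((g ^^ n) y) p \<ge> \<eta>}"
    by blast
  then have r: "strict_mono r" "\<And>n. dist ((g ^^ r n) y) p \<ge> \<eta>" by auto
  obtain z s where s: "strict_mono s" and "((\<lambda>n. (g ^^ r n) y) \<circ> s) \<longlonglongrightarrow> z"
    using M unfolding compact_def by (metis UNIV_I)
  define t where "t = r \<circ> s"
  have t: "strict_mono t" using r s by (simp add: t_def strict_mono_o)
  have lim: "(\<lambda>n. (g ^^ t n) y) \<longlonglongrightarrow> z"
    using \<open>_ \<longlonglongrightarrow> z\<close> by (simp add: t_def comp_def)
  have "dist z p \<ge> \<eta>"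
    by (rule tendsto_lowerbound[OF tendsto_dist[OF lim tendsto_const]]) (simp_all add: t_def r(2))
  moreover have "z = p"
  proof (rule iso)
    fix m
    have "(\<lambda>n. (g ^^ m) ((g ^^ t n) y)) \<longlonglongrightarrow> (g ^^ m) z"
      using isCont_funpow[OF g(2)] lim by (rule isCont_tendsto_compose)
    then have "(\<lambda>n. (g ^^ (m + t n)) y) \<longlonglongrightarrow> (g ^^ m) z" by (simp add: funpow_add)
    show "dist ((g ^^ m) z) p \<le> e"
      by (rule tendsto_upperbound[OF tendsto_dist[OF \<open>(\<lambda>n. (g ^^ (m + t n)) y) \<longlonglongrightarrow> _\<close> tendsto_const]])
        (simp_all add: y)
    have "(\<lambda>n. (inv g ^^ m) ((g ^^ t n) y)) \<longlonglongrightarrow> (inv g ^^ m) z"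
      using isCont_funpow[OF g(3)] lim by (rule isCont_tendsto_compose)
    from tendsto_dist[OF this tendsto_const]
    show "dist ((inv g ^^ m) z) p \<le> e"
    proof (rule tendsto_upperbound)
      have "dist ((inv g ^^ m) ((g ^^ t n) y)) p \<le> e" if "n \<ge> m" for n
        using that seq_suble[OF t, of n] y by (simp add: funpow_inv_cancel[OF g(1)])
      then show "\<forall>\<^sub>F n in sequentially. dist ((inv g ^^ m) ((g ^^ t n) y)) p \<le> e"
        unfolding eventually_sequentially by blast
    qed auto
  qed
  ultimately show False using \<eta> by simp
qed

lemma tendsto_of_isolated_inv:
  fixes g :: "'m::metric_space \<Rightarrow> 'm"
  assumes "compact (UNIV :: 'm set)" "bij g" "continuous_on UNIV g" "continuous_on UNIV (inv g)"
    and "\<And>y. (\<And>n. dist ((g ^^ n) y) p \<le> e) \<Longrightarrow> (\<And>n. dist ((inv g ^^ n) y) p \<le> e) \<Longrightarrow> y = p"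
    and "\<And>n. dist ((inv g ^^ n) y) p \<le> e"
  shows "(\<lambda>n. (inv g ^^ n) y) \<longlonglongrightarrow> p"
  by (rule tendsto_of_isolated[where e = e]) (use assms in \<open>auto simp: bij_imp_bij_inv inv_inv_eq\<close>)

text \<open>If \<open>p\<close> were Lyapunov stable, a nearby \<open>x \<noteq> p\<close> would converge to \<open>p\<close>. So some power of \<open>g\<close> carries a
neighbourhood \<open>W\<close> of \<open>x\<close> into a neighbourhood of \<open>p\<close> whose forward orbit never comes back near \<open>x\<close>.\<close>

lemma stable_isolated_imp_wandering:
  fixes g :: "'m::metric_space \<Rightarrow> 'm"
  assumes M: "compact (UNIV :: 'm set)" and g: "bij g" "continuous_on UNIV g" "continuous_on UNIV (inv g)"
    and iso: "\<And>y. (\<And>n. dist ((g ^^ n) y) p \<le> e) \<Longrightarrow> (\<And>n. dist ((inv g ^^ n) y) p \<le> e) \<Longrightarrow> y = p"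
    and e: "e > 0" and p: "\<not> open {p}"
    and stable: "\<And>e'. 0 < e' \<Longrightarrow> e' \<le> e \<Longrightarrow> \<exists>d>0. \<forall>x n. dist x p < d \<longrightarrow> dist ((g ^^ n) x) p \<le> e'"
  obtains N W where "N \<ge> 1" "open W" "W \<noteq> {}" "\<And>n. n \<ge> 1 \<Longrightarrow> (g ^^ (N * n)) ` W \<inter> W = {}"
proof -
  obtain d where d: "d > 0" "\<And>x n. dist x p < d \<Longrightarrow> dist ((g ^^ n) x) p \<le> e"
    using stable[OF e] by auto
  obtain x where x: "x \<noteq> p" "dist x p < d"
  proof -
    have "ball p d \<noteq> {p}" using p open_ball by metis
    moreover have "p \<in> ball p d" using d(1) by simp
    ultimately obtain x where "x \<in> ball p d" "x \<noteq> p" by blast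
    then show ?thesis using that by (simp add: dist_commute)
  qed
  define c where "c = min e (dist x p / 3)"
  have c: "0 < c" "c \<le> e" "c \<le> dist x p / 3" using e x by (auto simp: c_def)
  obtain d' where d': "d' > 0" "\<And>x n. dist x p < d' \<Longrightarrow> dist ((g ^^ n) x) p \<le> c"
    using stable[OF c(1,2)] by auto
  have "(\<lambda>n. (g ^^ n) x) \<longlonglongrightarrow> p"
    by (rule tendsto_of_isolated[OF M g iso]) (use d(2) x in auto)
  then have "\<forall>\<^sub>F n in sequentially. dist ((g ^^ n) x) p < d'"
    using d'(1) by (rule tendstoD)
  then obtain N where N: "N \<ge> 1" "dist ((g ^^ N) x) p < d'"
    unfolding eventually_sequentially by (meson le_trans linear)
  define W where "W = ball x c \<inter> (g ^^ N) -` ball p d'"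
  show thesis
  proof
    show "N \<ge> 1" by fact
    show "open W" unfolding W_def
      by (intro open_Int open_ball open_vimage continuous_on_funpow g)
    have "x \<in> W" using N c by (simp add: W_def dist_commute)
    then show "W \<noteq> {}" by auto
    fix n :: nat assume n: "n \<ge> 1"
    have "(g ^^ (N * n)) w \<notin> W" if w: "w \<in> W" for w
    proof -
      obtain k where k: "n = Suc k" using n by (cases n) auto
      have "N * n = N * k + N" by (simp add: k)
      then have "(g ^^ (N * n)) w = (g ^^ (N * k)) ((g ^^ N) w)" by (simp add: funpow_add)
      then have "dist ((g ^^ (N * n)) w) p \<le> c" using d'(2) w by (simp add: W_def dist_commute)
      moreover have "dist x p \<le> dist x ((g ^^ (N * n)) w) + dist ((g ^^ (N * n)) w) p" by (rule dist_triangle)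
      ultimately show ?thesis using c by (auto simp: W_def)
    qed
    then show "(g ^^ (N * n)) ` W \<inter> W = {}" by blast
  qed
qed

text \<open>Instability yields points \<open>x j\<close> tending to \<open>p\<close> whose orbits leave the \<open>e'\<close>-ball. The first points
outside have a long backward orbit inside the ball, since it takes ever longer to leave. They
accumulate at a point \<open>q\<close> off \<open>p\<close> whose whole backward orbit stays near \<open>p\<close>.\<close>

lemma unstable_isolated_imp_unstable_manifold:
  fixes g :: "'m::metric_space \<Rightarrow> 'm"
  assumes M: "compact (UNIV :: 'm set)" and g: "bij g" "continuous_on UNIV g" "continuous_on UNIV (inv g)"
    and fix_p: "g p = p"
    and iso: "\<And>y. (\<And>n. dist ((g ^^ n) y) p \<le> e) \<Longrightarrow> (\<And>n. dist ((inv g ^^ n) y) p \<le> e) \<Longrightarrow> y = p"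
    and e': "0 < e'" "e' \<le> e"
    and unstable: "\<And>d. d > 0 \<Longrightarrow> \<exists>x n. dist x p < d \<and> dist ((g ^^ n) x) p > e'"
  obtains q where "q \<noteq> p" "(\<lambda>n. (inv g ^^ n) q) \<longlonglongrightarrow> p"
proof -
  have "\<exists>x n. dist x p < 1 / Suc j \<and> dist ((g ^^ n) x) p > e' \<and> (\<forall>i<n. dist ((g ^^ i) x) p \<le> e')" for j
  proof -
    obtain x where x: "dist x p < 1 / Suc j" "\<exists>n. dist ((g ^^ n) x) p > e'"
      using unstable[of "1 / Suc j"] by auto
    from x(2) obtain n where "dist ((g ^^ n) x) p > e'" "\<forall>i<n. \<not> dist ((g ^^ i) x) p > e'"
      using exists_least_iff[of "\<lambda>n. dist ((g ^^ n) x) p > e'"] by blast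
    then show ?thesis using x(1) by (meson not_less)
  qed
  then obtain x N where x: "\<And>j. dist (x j) p < 1 / Suc j"
    and N: "\<And>j. dist ((g ^^ N j) (x j)) p > e'" "\<And>j i. i < N j \<Longrightarrow> dist ((g ^^ i) (x j)) p \<le> e'"
    by metis
  have x_lim: "x \<longlonglongrightarrow> p"
  proof (rule metric_tendsto_imp_tendsto)
    show "(\<lambda>j. 1 / real (Suc j)) \<longlonglongrightarrow> 0" using LIMSEQ_Suc[OF lim_1_over_n] by simp
    show "\<forall>\<^sub>F j in sequentially. dist (x j) p \<le> dist (1 / real (Suc j)) 0"
      using x by (auto intro!: always_eventually less_imp_le)
  qed
  have gp: "(g ^^ i) p = p" for i by (induction i) (auto simp: fix_p)
  have N_large: "\<forall>\<^sub>F j in sequentially. N j \<ge> m" for m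
  proof -
    have "\<forall>\<^sub>F j in sequentially. \<forall>i\<in>{..<m}. dist ((g ^^ i) (x j)) p < e'"
    proof (rule eventually_ball_finite)
      show "\<forall>i\<in>{..<m}. \<forall>\<^sub>F j in sequentially. dist ((g ^^ i) (x j)) p < e'"
        using isCont_tendsto_compose[OF isCont_funpow[OF g(2)] x_lim] e'(1)
        by (auto simp: gp dest!: tendstoD[where e = e'])
    qed simp
    then show ?thesis
    proof eventually_elim
      case (elim j)
      then show ?case using N(1)[of j] by (meson lessThan_iff not_less not_less_iff_gr_or_eq)
    qed
  qed
  obtain q r where r: "strict_mono r" and "((\<lambda>j. (g ^^ N j) (x j)) \<circ> r) \<longlonglongrightarrow> q"
    using M unfolding compact_def by (metis UNIV_I)
  then have lim: "(\<lambda>j. (g ^^ N (r j)) (x (r j))) \<longlonglongrightarrow> q" by (simp add: comp_def)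
  have "dist q p \<ge> e'"
    by (rule tendsto_lowerbound[OF tendsto_dist[OF lim tendsto_const]]) (simp_all add: less_imp_le[OF N(1)])
  then have "q \<noteq> p" using e' by auto
  have near: "dist ((inv g ^^ Suc m) q) p \<le> e'" for m
  proof (rule tendsto_upperbound)
    show "(\<lambda>j. dist ((inv g ^^ Suc m) ((g ^^ N (r j)) (x (r j)))) p) \<longlonglongrightarrow> dist ((inv g ^^ Suc m) q) p"
      by (intro tendsto_dist tendsto_const isCont_tendsto_compose[OF isCont_funpow[OF g(3)] lim])
    have "\<forall>\<^sub>F j in sequentially. N (r j) \<ge> Suc m"
      using eventually_subseq[OF r N_large] .
    then show "\<forall>\<^sub>F j in sequentially. dist ((inv g ^^ Suc m) ((g ^^ N (r j)) (x (r j)))) p \<le> e'"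
    proof eventually_elim
      case (elim j)
      show ?case unfolding funpow_inv_cancel[OF g(1) elim] using elim by (intro N(2)) simp
    qed
  qed simp
  have "(\<lambda>n. (inv g ^^ n) (inv g q)) \<longlonglongrightarrow> p"
  proof (rule tendsto_of_isolated_inv[OF M g iso])
    show "dist ((inv g ^^ n) (inv g q)) p \<le> e" for n
      using near[of n] e' by (simp add: funpow_swap1)
  qed
  then have "(\<lambda>n. (inv g ^^ Suc n) q) \<longlonglongrightarrow> p" by (simp add: funpow_swap1)
  then have "(\<lambda>n. (inv g ^^ n) q) \<longlonglongrightarrow> p" by (rule LIMSEQ_imp_Suc)
  with \<open>q \<noteq> p\<close> show thesis by (rule that)
qed


lemma funpow_periodic:
  assumes "(h ^^ k) p = p"
  shows "(h ^^ (k * n)) p = p"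
  by (induction n) (use assms in \<open>auto simp: funpow_add\<close>)

lemma tendsto_orbit_of_period:
  fixes h :: "'m::metric_space \<Rightarrow> 'm"
  assumes h: "continuous_on UNIV h" and k: "k > 0" "(h ^^ k) p = p"
    and lim: "(\<lambda>n. ((h ^^ k) ^^ n) u) \<longlonglongrightarrow> p"
  shows "(\<lambda>n. dist ((h ^^ n) u) ((h ^^ n) p)) \<longlonglongrightarrow> 0"
proof (rule tendstoI)
  fix \<eta> :: real assume \<eta>: "\<eta> > 0"
  have "\<forall>\<^sub>F n in sequentially. \<forall>j\<in>{..<k}. dist ((h ^^ j) (((h ^^ k) ^^ n) u)) ((h ^^ j) p) < \<eta>"
  proof (rule eventually_ball_finite)
    show "\<forall>j\<in>{..<k}. \<forall>\<^sub>F n in sequentially. dist ((h ^^ j) (((h ^^ k) ^^ n) u)) ((h ^^ j) p) < \<eta>"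
      using isCont_tendsto_compose[OF isCont_funpow[OF h] lim] \<eta> by (auto dest: tendstoD)
  qed simp
  then obtain n0 where n0: "\<And>n j. n \<ge> n0 \<Longrightarrow> j < k \<Longrightarrow>
      dist ((h ^^ j) (((h ^^ k) ^^ n) u)) ((h ^^ j) p) < \<eta>"
    by (auto simp: eventually_sequentially)
  have "dist ((h ^^ n) u) ((h ^^ n) p) < \<eta>" if n: "n \<ge> k * n0" for n
  proof -
    \<comment> \<open>only the finitely many powers \<open>h ^^ j\<close> with \<open>j < k\<close> separate \<open>h\<close> from \<open>h ^^ k\<close>\<close>
    have split: "(h ^^ n) v = (h ^^ (n mod k)) ((h ^^ (k * (n div k))) v)" for v
      by (metis comp_apply funpow_add mod_mult_div_eq)
    have "n div k \<ge> n0" using n k(1) by (simp add: less_eq_div_iff_mult_less_eq mult.commute)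
    from n0[OF this, of "n mod k"] k(1)
    show ?thesis by (simp add: split[of u] split[of p] funpow_periodic[OF k(2)] funpow_mult)
  qed
  then show "\<forall>\<^sub>F n in sequentially. dist (dist ((h ^^ n) u) ((h ^^ n) p)) 0 < \<eta>"
    by (auto simp: eventually_sequentially)
qed

text \<open>With \<open>q \<noteq> p\<close> on the unstable manifold, take \<open>m\<close> so large that \<open>a = f\<^sup>-\<^sup>k\<^sup>m q\<close> is close to \<open>p\<close>, and let \<open>w\<close> be a
point near \<open>a\<close> that returns near \<open>a\<close>, after a time greater than \<open>k m\<close>. Follow the backward orbit of \<open>q\<close> up
to time \<open>0\<close>, jump to the orbit of \<open>w\<close>, which passes near \<open>q\<close> at time \<open>k m\<close>, and when it has
returned near \<open>a\<close>, jump to the orbit of \<open>p\<close>. A point that shadows this pseudo-orbit stays near the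
orbit of \<open>p\<close> in the distant past and future, hence is asymptotic to it by isolation, but is close to
\<open>q\<close> at time \<open>0\<close>; it is a homoclinic point.\<close>

lemma nonshadowable_if_isolated_recurrent_saddle:
  fixes f :: "'m::metric_space \<Rightarrow> 'm"
  assumes M: "compact (UNIV :: 'm set)" and f: "bij f" "continuous_on UNIV f" "continuous_on UNIV (inv f)"
    and k: "k > 0" "(f ^^ k) p = p"
    and e: "e > 0"
    and iso: "\<And>y. (\<And>n. dist (((f ^^ k) ^^ n) y) p \<le> e) \<Longrightarrow>
                  (\<And>n. dist (((inv f ^^ k) ^^ n) y) p \<le> e) \<Longrightarrow> y = p"
    and q: "q \<noteq> p" "(\<lambda>n. ((inv f ^^ k) ^^ n) q) \<longlonglongrightarrow> p"
    and nonwandering: "\<And>N W. N \<ge> 1 \<Longrightarrow> open W \<Longrightarrow> W \<noteq> {} \<Longrightarrow> \<exists>n\<ge>1. (f ^^ (N * n)) ` W \<inter> W \<noteq> {}"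
    and no_homoclinic: "\<not> (\<exists>q. homoclinic_point p f q)"
  shows "nonshadowable f"
proof -
  have inv_pow: "inv (f ^^ k) = inv f ^^ k" using f(1) by (simp add: inv_fn)
  have g: "bij (f ^^ k)" "continuous_on UNIV (f ^^ k)" "continuous_on UNIV (inv (f ^^ k))"
    using f by (auto simp: bij_fn inv_pow intro: continuous_on_funpow)
  have iso': "y = p" if "\<And>n. dist (((f ^^ k) ^^ n) y) p \<le> e" "\<And>n. dist ((inv (f ^^ k) ^^ n) y) p \<le> e" for y
    using iso that by (simp add: inv_pow)
  have inv_p: "(inv f ^^ k) p = p"
    using k(2) g(1) by (metis bij_inv_eq_iff inv_pow)
  have period: "iterate f (int (k * n)) p = p" for n
    by (simp only: iterate_of_nat funpow_periodic[OF k(2)])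
  define \<epsilon> where "\<epsilon> = min (e / 2) (dist q p / 3)"
  have \<epsilon>: "\<epsilon> > 0" "2 * \<epsilon> \<le> e" "3 * \<epsilon> \<le> dist q p" using e q(1) by (auto simp: \<epsilon>_def)
  have "\<exists>x. pseudo_orbit \<delta> f x \<and> \<not> (\<exists>y. shadowed \<epsilon> f x y)" if \<delta>: "\<delta> > 0" for \<delta>
  proof -
    obtain m where m: "dist (((inv f ^^ k) ^^ m) q) p < \<delta> / 2"
      using tendstoD[OF q(2), of "\<delta> / 2"] \<delta> by (auto simp: eventually_sequentially)
    define a where "a = ((inv f ^^ k) ^^ m) q"
    have a: "(f ^^ (k * m)) a = q"
      using iterate_add[OF f(1), of "int (k * m)" "- int (k * m)" q]
      unfolding a_def funpow_mult by (simp only: iterate_of_nat iterate_minus_of_nat) (simp add: iterate_def)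
    \<comment> \<open>\<open>f\<^sup>k\<^sup>m\<close> maps \<open>W\<close> close to \<open>q\<close>, and \<open>W\<close> itself is close to \<open>p\<close>\<close>
    define W where "W = ball a (\<delta> / 2) \<inter> (f ^^ (k * m)) -` ball q (min \<delta> \<epsilon>)"
    have "open W" unfolding W_def
      by (intro open_Int open_ball open_vimage continuous_on_funpow f)
    moreover have "a \<in> W" using a \<delta> \<epsilon> by (simp add: W_def)
    ultimately obtain n where "n \<ge> 1" "(f ^^ (k * (m + 1) * n)) ` W \<inter> W \<noteq> {}"
      using nonwandering[of "k * (m + 1)" W] k(1) by auto
    then obtain w where w: "w \<in> W" "(f ^^ (k * (m + 1) * n)) w \<in> W" by blast
    define l where "l = (m + 1) * n - m"
    have l: "(m + 1) * n = l + m" "l \<ge> 1"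
    proof -
      have "(m + 1) * n \<ge> (m + 1) * 1" using \<open>n \<ge> 1\<close> by (intro mult_le_mono) auto
      then show "(m + 1) * n = l + m" "l \<ge> 1" by (auto simp: l_def)
    qed
    \<comment> \<open>\<open>T\<close> is the time that \<open>w\<close> needs from near \<open>q\<close> back to near \<open>a\<close>; as a multiple of the period it
        makes the orbit of \<open>p\<close> enter in the right phase\<close>
    define T where "T = k * l"
    have T: "k * (m + 1) * n = T + k * m" "T \<ge> 1"
      using l k(1) by (auto simp: T_def mult.assoc algebra_simps simp del: mult_Suc_right)
    have iter_w: "dist (iterate f (int (k * m)) w) q < min \<delta> \<epsilon>"
      using w(1) by (simp only: iterate_of_nat) (simp add: W_def dist_commute)
    have iter_T: "dist (iterate f (int T + int (k * m)) w) p < \<delta>"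
    proof -
      have "dist a ((f ^^ (T + k * m)) w) < \<delta> / 2" using w(2)[unfolded T(1)] by (simp add: W_def)
      moreover have "dist ((f ^^ (T + k * m)) w) p \<le> dist ((f ^^ (T + k * m)) w) a + dist a p"
        by (rule dist_triangle)
      ultimately have "dist ((f ^^ (T + k * m)) w) p < \<delta>" using m by (simp add: a_def dist_commute)
      then show ?thesis by (simp only: iterate_of_nat flip: of_nat_add)
    qed
    define x where "x = (\<lambda>i. if i < 0 then iterate f i q
      else if i < int T then iterate f (i + int (k * m)) w else iterate f i p)"
    have "pseudo_orbit \<delta> f x"
      unfolding pseudo_orbit_def
    proof
      fix i :: int
      have f_iter: "f (iterate f j v) = iterate f (j + 1) v" for j v
        using iterate_succ[OF f(1)] by simp
      consider "i < - 1" | "i = - 1" | "0 \<le> i" "i < int T - 1" | "i = int T - 1" | "i \<ge> int T" by linarith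
      then show "dist (x (i + 1)) (f (x i)) < \<delta>"
      proof cases
        case 2
        have "iterate f 0 q = q" by (simp add: iterate_def)
        then show ?thesis using 2 T(2) iter_w by (simp add: x_def f_iter)
      next
        case 4
        have "x (i + 1) = p" using 4 period by (simp add: x_def T_def del: of_nat_mult)
        moreover have "f (x i) = iterate f (int T + int (k * m)) w"
          using 4 T(2) by (simp add: x_def f_iter)
        ultimately show ?thesis using iter_T by (simp add: dist_commute)
      qed (use \<delta> in \<open>auto simp: x_def f_iter algebra_simps\<close>)
    qed
    moreover have False if y: "shadowed \<epsilon> f x y" for y
    proof -
      have near: "dist (x i) (iterate f i y) < \<epsilon>" for i using y by (simp add: shadowed_def)
      have "y \<noteq> p"
      proof
        assume "y = p"
        have "dist (iterate f (int (k * m)) w) p < \<epsilon>"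
          using near[of 0] T(2) \<open>y = p\<close> by (simp add: x_def iterate_def del: of_nat_mult)
        moreover have "dist q p \<le> dist q (iterate f (int (k * m)) w) + dist (iterate f (int (k * m)) w) p"
          by (rule dist_triangle)
        ultimately show False using iter_w \<epsilon> by (simp add: dist_commute)
      qed
      have "(\<lambda>n. ((f ^^ k) ^^ n) (((f ^^ k) ^^ l) y)) \<longlonglongrightarrow> p"
      proof (rule tendsto_of_isolated[OF M g iso'])
        fix n
        have "x (int (k * (n + l))) = p"
          using period[of "n + l"] k(1) by (simp add: x_def T_def algebra_simps flip: of_nat_add of_nat_mult)
        then have "dist p ((f ^^ (k * (n + l))) y) < \<epsilon>"
          using near[of "int (k * (n + l))"] by (simp only: iterate_of_nat)
        moreover have "((f ^^ k) ^^ n) (((f ^^ k) ^^ l) y) = (f ^^ (k * (n + l))) y"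
          by (simp add: funpow_mult distrib_left funpow_add)
        ultimately show "dist (((f ^^ k) ^^ n) (((f ^^ k) ^^ l) y)) p \<le> e"
          using \<epsilon> by (simp add: dist_commute)
      qed
      then have "(\<lambda>n. ((f ^^ k) ^^ (n + l)) y) \<longlonglongrightarrow> p" by (simp add: funpow_add)
      then have "(\<lambda>n. ((f ^^ k) ^^ n) y) \<longlonglongrightarrow> p" by (rule LIMSEQ_offset)
      then have "y \<in> stable_manifold p f"
        unfolding stable_manifold_def iterate_of_nat
        using tendsto_orbit_of_period[OF f(2) k] by simp
      moreover have "y \<in> unstable_manifold p f"
      proof -
        obtain n0 where n0: "\<And>n. n \<ge> n0 \<Longrightarrow> dist (((inv f ^^ k) ^^ n) q) p < \<epsilon>"
          using tendstoD[OF q(2) \<epsilon>(1)] by (auto simp: eventually_sequentially)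
        define N where "N = Suc n0"
        have "(\<lambda>n. (inv (f ^^ k) ^^ n) ((inv (f ^^ k) ^^ N) y)) \<longlonglongrightarrow> p"
        proof (rule tendsto_of_isolated_inv[OF M g iso'])
          fix n
          have "k * (n + N) > 0" using k(1) by (simp add: N_def)
          then have "- int (k * (n + N)) < 0" by linarith
          then have "x (- int (k * (n + N))) = (inv f ^^ (k * (n + N))) q"
            by (simp only: x_def if_True iterate_minus_of_nat)
          then have "dist ((inv f ^^ (k * (n + N))) q) ((inv f ^^ (k * (n + N))) y) < \<epsilon>"
            using near[of "- int (k * (n + N))"] by (simp only: iterate_minus_of_nat)
          moreover have "dist ((inv f ^^ (k * (n + N))) q) p < \<epsilon>"
            using n0[of "n + N"] by (simp add: N_def funpow_mult)
          moreover have "dist ((inv f ^^ (k * (n + N))) y) p \<le>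
              dist ((inv f ^^ (k * (n + N))) y) ((inv f ^^ (k * (n + N))) q) + dist ((inv f ^^ (k * (n + N))) q) p"
            by (rule dist_triangle)
          ultimately have "dist ((inv f ^^ (k * (n + N))) y) p \<le> e"
            using \<epsilon> by (simp add: dist_commute)
          then show "dist ((inv (f ^^ k) ^^ n) ((inv (f ^^ k) ^^ N) y)) p \<le> e"
            by (simp add: inv_pow funpow_mult distrib_left funpow_add)
        qed
        then have "(\<lambda>n. ((inv f ^^ k) ^^ (n + N)) y) \<longlonglongrightarrow> p" by (simp add: funpow_add inv_pow)
        then have "(\<lambda>n. ((inv f ^^ k) ^^ n) y) \<longlonglongrightarrow> p" by (rule LIMSEQ_offset)
        then show ?thesis
          unfolding unstable_manifold_def iterate_minus_of_nat
          using tendsto_orbit_of_period[OF f(3) k(1) inv_p] by simp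
      qed
      ultimately show False using no_homoclinic \<open>y \<noteq> p\<close> by (auto simp: homoclinic_point_def)
    qed
    ultimately show ?thesis by blast
  qed
  then show ?thesis using \<epsilon>(1) by (auto simp: nonshadowable_def)
qed

section \<open>Linear maps without eigenvalues on the unit circle\<close>

lemma linear_funpow: "linear (L :: 'e::real_vector \<Rightarrow> 'e) \<Longrightarrow> linear (L ^^ n)"
proof (induction n)
  case 0
  show ?case by (simp add: linear_iff)
next
  case (Suc n)
  then show ?case using linear_compose[of "L ^^ n" L] by (simp add: o_def)
qed

text \<open>The complexification of a real space: \<open>(u, w)\<close> stands for \<open>u + \<i> w\<close>.\<close>

definition complex_scale :: "complex \<Rightarrow> 'e::real_vector \<times> 'e \<Rightarrow> 'e \<times> 'e" where
  "complex_scale z v = (Re z *\<^sub>R fst v - Im z *\<^sub>R snd v, Im z *\<^sub>R fst v + Re z *\<^sub>R snd v)"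

lemma complex_scale_simps [simp]:
  "complex_scale 0 v = 0" "complex_scale 1 v = v" "complex_scale z 0 = 0"
  by (auto simp: complex_scale_def zero_prod_def)

lemma complex_scale_add: "complex_scale (a + b) v = complex_scale a v + complex_scale b v"
  and complex_scale_add_right: "complex_scale a (v + w) = complex_scale a v + complex_scale a w"
  and complex_scale_mult: "complex_scale (a * b) v = complex_scale a (complex_scale b v)"
  and complex_scale_minus: "complex_scale (- a) v = - complex_scale a v"
  by (auto simp: complex_scale_def prod_eq_iff algebra_simps)

lemma norm_complex_scale:
  fixes v :: "'e::real_inner \<times> 'e"
  shows "norm (complex_scale z v) = cmod z * norm v"
proof (rule power2_eq_imp_eq)
  obtain a b where v: "v = (a, b)" by (cases v)
  have "(norm (complex_scale z v))\<^sup>2 = (norm (Re z *\<^sub>R a - Im z *\<^sub>R b))\<^sup>2 + (norm (Im z *\<^sub>R a + Re z *\<^sub>R b))\<^sup>2"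
    by (simp add: complex_scale_def v norm_Pair)
  also have "\<dots> = ((Re z)\<^sup>2 + (Im z)\<^sup>2) * ((norm a)\<^sup>2 + (norm b)\<^sup>2)"
    unfolding power2_norm_eq_inner
    by (simp add: inner_diff_left inner_diff_right inner_add_left inner_add_right inner_commute[of b a]
        power2_eq_square algebra_simps)
  also have "\<dots> = (cmod z * norm v)\<^sup>2"
    by (simp add: power_mult_distrib cmod_power2 v norm_Pair)
  finally show "(norm (complex_scale z v))\<^sup>2 = (cmod z * norm v)\<^sup>2" .
qed auto

lemma complex_scale_eq_0_iff [simp]:
  fixes v :: "'e::real_inner \<times> 'e"
  shows "complex_scale z v = 0 \<longleftrightarrow> z = 0 \<or> v = 0"
  using norm_complex_scale[of z v] by (metis mult_eq_0_iff norm_eq_zero)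

lemma complex_scale_map_prod:
  assumes "linear L"
  shows "map_prod L L (complex_scale z v) = complex_scale z (map_prod L L v)"
  using assms by (cases v) (simp add: complex_scale_def linear_diff linear_add linear_scale)

text \<open>\<open>P(L) v\<close>, evaluated by Horner's scheme.\<close>

definition poly_act :: "('e::real_vector \<Rightarrow> 'e) \<Rightarrow> complex poly \<Rightarrow> 'e \<times> 'e \<Rightarrow> 'e \<times> 'e" where
  "poly_act L P v = fold_coeffs (\<lambda>a w. complex_scale a v + map_prod L L w) P 0"

context
  fixes L :: "'e::euclidean_space \<Rightarrow> 'e"
  assumes L: "linear L"
begin

lemma map_prod_0: "map_prod L L 0 = 0"
  and map_prod_add: "map_prod L L (v + w) = map_prod L L v + map_prod L L w"
  and map_prod_minus: "map_prod L L (- v) = - map_prod L L v"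
  and map_prod_diff: "map_prod L L (v - w) = map_prod L L v - map_prod L L w"
  by (cases v; cases w; simp add: zero_prod_def linear_0[OF L] linear_add[OF L] linear_neg[OF L] linear_diff[OF L])+

lemma poly_act_0: "poly_act L 0 v = 0"
  by (simp add: poly_act_def)

lemma poly_act_pCons: "poly_act L (pCons a P) v = complex_scale a v + map_prod L L (poly_act L P v)"
  by (cases "a = 0 \<and> P = 0") (auto simp: poly_act_def map_prod_0)

lemma poly_act_add: "poly_act L (P + Q) v = poly_act L P v + poly_act L Q v"
proof (induction P arbitrary: Q)
  case 0
  show ?case by (simp add: poly_act_0)
next
  case (pCons a P)
  then show ?case
    by (cases Q) (simp add: poly_act_pCons complex_scale_add map_prod_add algebra_simps)
qed

lemma poly_act_smult: "poly_act L (smult a P) v = complex_scale a (poly_act L P v)"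
  by (induction P)
    (simp_all add: poly_act_0 poly_act_pCons complex_scale_mult complex_scale_add_right complex_scale_map_prod[OF L])

lemma poly_act_linear_factor:
  "poly_act L ([:- z, 1:] * P) v = poly_act L P (map_prod L L v - complex_scale z v)"
proof (induction P)
  case 0
  show ?case by (simp add: poly_act_0)
next
  case (pCons a P)
  have eq: "[:- z, 1:] * Q = smult (- z) Q + pCons 0 Q" for Q :: "complex poly" by simp
  have commute: "complex_scale a (complex_scale b u) = complex_scale b (complex_scale a u)" for b and u :: "'e \<times> 'e"
    by (metis complex_scale_mult mult.commute)
  have minus: "complex_scale b (u - w) = complex_scale b u - complex_scale b w" for b and u w :: "'e \<times> 'e"
    by (simp add: complex_scale_def prod_eq_iff algebra_simps)
  have IH: "- complex_scale z (poly_act L P v) + map_prod L L (poly_act L P v) =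
      poly_act L P (map_prod L L v - complex_scale z v)"
    using pCons.IH unfolding eq
    by (simp add: poly_act_add poly_act_smult poly_act_pCons complex_scale_minus del: smult_minus_left)
  show ?case
    unfolding eq poly_act_add poly_act_smult poly_act_pCons IH[symmetric]
    by (simp add: complex_scale_minus complex_scale_add_right map_prod_add map_prod_minus map_prod_diff minus
        complex_scale_map_prod[OF L] commute algebra_simps)
qed

text \<open>Split off the linear factors of \<open>P\<close> one at a time. They commute with \<open>L\<close>, so \<open>(L - z) v\<close> either
vanishes, and \<open>v\<close> is an eigenvector, or is annihilated by a polynomial of smaller degree.\<close>

lemma eigenvector_of_annihilating_poly:
  assumes "P \<noteq> 0" "v \<noteq> 0" "v \<in> S \<times> S" "poly_act L P v = 0"
    and S: "subspace S" "L ` S \<subseteq> S"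
  shows "\<exists>z u. u \<noteq> 0 \<and> u \<in> S \<times> S \<and> map_prod L L u = complex_scale z u"
  using assms(1-4)
proof (induction "degree P" arbitrary: P v)
  case 0
  then obtain a where "P = [:a:]" "a \<noteq> 0" by (metis degree_eq_zeroE pCons_0_0)
  then show ?case using 0 by (simp add: poly_act_pCons poly_act_0 map_prod_0)
next
  case (Suc n)
  then have "\<not> constant (poly P)" by (simp add: constant_degree)
  then obtain z where "poly P z = 0" using fundamental_theorem_of_algebra by blast
  then obtain Q where Q: "P = [:- z, 1:] * Q" using poly_eq_0_iff_dvd by (metis dvdE)
  have "Q \<noteq> 0" using Suc.prems(1) Q by auto
  then have "degree P = Suc (degree Q)" unfolding Q by (subst degree_mult_eq) auto
  then have deg: "n = degree Q" using Suc.hyps(2) by simp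
  define w where "w = map_prod L L v - complex_scale z v"
  show ?case
  proof (cases "w = 0")
    case True
    then have "map_prod L L v = complex_scale z v" by (simp add: w_def)
    then show ?thesis using Suc.prems by blast
  next
    case False
    have "poly_act L Q w = 0" using Suc.prems(4) unfolding Q poly_act_linear_factor w_def .
    moreover have "w \<in> S \<times> S"
      using Suc.prems(3) S by (cases v) (auto simp: w_def complex_scale_def intro!: subspace_diff subspace_add subspace_scale)
    ultimately show ?thesis using Suc.hyps(1)[OF deg \<open>Q \<noteq> 0\<close> False] by blast
  qed
qed

text \<open>The vectors \<open>x, L x, L\<^sup>2 x, \<dots>\<close> are linearly dependent.\<close>

lemma annihilating_poly:
  obtains P where "P \<noteq> 0" "poly_act L P (x, 0) = 0"
proof -
  define m where "m = DIM('e)"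
  have "\<exists>c :: nat \<Rightarrow> real. (\<exists>i\<le>m. c i \<noteq> 0) \<and> (\<Sum>i\<le>m. c i *\<^sub>R (L ^^ i) x) = 0"
  proof (cases "inj_on (\<lambda>i. (L ^^ i) x) {..m}")
    case True
    define X where "X = (\<lambda>i. (L ^^ i) x) ` {..m}"
    have "card X = Suc m" using True by (simp add: X_def card_image)
    then have "dependent X" by (intro dependent_biggerset) (auto simp: m_def X_def)
    then obtain u where u: "(\<Sum>v\<in>X. u v *\<^sub>R v) = 0" "\<exists>v\<in>X. u v \<noteq> 0"
      by (auto simp: dependent_finite X_def)
    have "(\<Sum>i\<le>m. u ((L ^^ i) x) *\<^sub>R (L ^^ i) x) = 0"
      using u(1) True by (simp add: X_def sum.reindex)
    then show ?thesis using u(2) by (intro exI[of _ "\<lambda>i. u ((L ^^ i) x)"]) (auto simp: X_def)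
  next
    case False
    then obtain i j where ij: "i \<le> m" "j \<le> m" "i \<noteq> j" "(L ^^ i) x = (L ^^ j) x"
      by (auto simp: inj_on_def)
    define c :: "nat \<Rightarrow> real" where "c k = (if k = i then 1 else 0) - (if k = j then 1 else 0)" for k
    have "(\<Sum>k\<le>m. c k *\<^sub>R (L ^^ k) x) = (L ^^ i) x - (L ^^ j) x"
      using ij by (simp add: c_def scaleR_diff_left sum_subtractf if_distrib[of "\<lambda>a. a *\<^sub>R _"] cong: if_cong)
    then show ?thesis using ij by (intro exI[of _ c]) (auto simp: c_def)
  qed
  then obtain c i where c: "i \<le> m" "c i \<noteq> (0::real)" "(\<Sum>i\<le>m. c i *\<^sub>R (L ^^ i) x) = 0" by blast
  define P where "P = (\<Sum>i\<le>m. monom (complex_of_real (c i)) i)"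
  have monom: "poly_act L (monom (complex_of_real a) i) (x, 0) = (a *\<^sub>R (L ^^ i) x, 0)" for a i
    by (induction i) (simp_all add: monom_0 monom_Suc poly_act_pCons poly_act_0 map_prod_0 complex_scale_def
        linear_0[OF L] linear_scale[OF L])
  have "poly_act L (\<Sum>i\<in>A. monom (complex_of_real (c i)) i) (x, 0) = (\<Sum>i\<in>A. (c i *\<^sub>R (L ^^ i) x, 0))"
    if "finite A" for A
    using that by (induction A) (auto simp: poly_act_0 poly_act_add monom)
  then have "poly_act L P (x, 0) = 0"
    using c(3) by (simp add: P_def prod_eq_iff fst_sum snd_sum)
  moreover have "coeff P i = complex_of_real (c i)" using c(1) by (simp add: P_def coeff_sum)
  then have "P \<noteq> 0" using c(2) by auto
  ultimately show thesis using that by blast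
qed

end

text \<open>The points with bounded two-sided orbit form an invariant subspace \<open>S\<close>. If it is nonzero, then \<open>L\<close>
has a complex eigenvector in the complexification of \<open>S\<close>, and boundedness of its orbit in both
directions makes the modulus of the eigenvalue neither more nor less than 1.\<close>

lemma bounded_orbit_eq_0:
  fixes L L' :: "'e::euclidean_space \<Rightarrow> 'e"
  assumes L: "linear L" "linear L'" "\<And>x. L' (L x) = x" "\<And>x. L (L' x) = x"
    and ev: "\<And>z u w. u \<noteq> 0 \<or> w \<noteq> 0 \<Longrightarrow> L u = Re z *\<^sub>R u - Im z *\<^sub>R w \<Longrightarrow>
                L w = Im z *\<^sub>R u + Re z *\<^sub>R w \<Longrightarrow> cmod z \<noteq> 1"
    and x: "\<And>n. norm ((L ^^ n) x) \<le> C" "\<And>n. norm ((L' ^^ n) x) \<le> C"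
  shows "x = 0"
proof (rule ccontr)
  assume "x \<noteq> 0"
  define S where "S = {x. \<exists>C. \<forall>n. norm ((L ^^ n) x) \<le> C \<and> norm ((L' ^^ n) x) \<le> C}"
  have lin: "linear (L ^^ n)" "linear (L' ^^ n)" for n
    using L(1,2) by (auto intro: linear_funpow)
  have "subspace S"
  proof (rule subspaceI)
    show "0 \<in> S" using lin[THEN linear_0] by (auto simp: S_def intro!: exI[of _ 0])
  next
    fix y y' assume "y \<in> S" "y' \<in> S"
    then obtain C C' where "\<And>n. norm ((L ^^ n) y) \<le> C \<and> norm ((L' ^^ n) y) \<le> C"
      "\<And>n. norm ((L ^^ n) y') \<le> C' \<and> norm ((L' ^^ n) y') \<le> C'" by (auto simp: S_def)
    then have "\<forall>n. norm ((L ^^ n) (y + y')) \<le> C + C' \<and> norm ((L' ^^ n) (y + y')) \<le> C + C'"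
      by (simp add: lin[THEN linear_add] norm_triangle_mono)
    then show "y + y' \<in> S" by (auto simp: S_def)
  next
    fix a y assume "y \<in> S"
    then obtain C where "\<And>n. norm ((L ^^ n) y) \<le> C \<and> norm ((L' ^^ n) y) \<le> C" by (auto simp: S_def)
    then have "\<forall>n. norm ((L ^^ n) (a *\<^sub>R y)) \<le> \<bar>a\<bar> * C \<and> norm ((L' ^^ n) (a *\<^sub>R y)) \<le> \<bar>a\<bar> * C"
      by (simp add: lin[THEN linear_scale] mult_left_mono)
    then show "a *\<^sub>R y \<in> S" by (auto simp: S_def)
  qed
  moreover have "L ` S \<subseteq> S"
  proof safe
    fix y assume "y \<in> S"
    then obtain C where C: "\<And>n. norm ((L ^^ n) y) \<le> C" "\<And>n. norm ((L' ^^ n) y) \<le> C" by (auto simp: S_def)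
    have "norm ((L' ^^ n) (L y)) \<le> max C (norm (L y))" for n
    proof (cases n)
      case (Suc k)
      then have "(L' ^^ n) (L y) = (L' ^^ k) y" by (simp add: funpow_swap1 L(3))
      then show ?thesis using C(2)[of k] by simp
    qed auto
    moreover have "norm ((L ^^ n) (L y)) \<le> max C (norm (L y))" for n
      using C(1)[of "Suc n"] by (simp add: funpow_swap1)
    ultimately show "L y \<in> S" by (auto simp: S_def)
  qed
  moreover obtain P where "P \<noteq> 0" "poly_act L P (x, 0) = 0" using annihilating_poly[OF L(1)] .
  moreover have "(x, 0) \<in> S \<times> S" using x subspace_0[OF \<open>subspace S\<close>] unfolding S_def by blast
  ultimately obtain z v where v: "v \<noteq> 0" "v \<in> S \<times> S" "map_prod L L v = complex_scale z v"
    using eigenvector_of_annihilating_poly[OF L(1)] \<open>x \<noteq> 0\<close> by (metis Pair_inject zero_prod_def)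
  obtain u w where uw: "v = (u, w)" by (cases v)
  then have "L u = Re z *\<^sub>R u - Im z *\<^sub>R w" "L w = Im z *\<^sub>R u + Re z *\<^sub>R w" "u \<noteq> 0 \<or> w \<noteq> 0"
    using v(1,3) by (auto simp: complex_scale_def zero_prod_def)
  then have z: "cmod z \<noteq> 1" using ev by blast
  have pow: "map_prod (L ^^ n) (L ^^ n) v = complex_scale (z ^ n) v" for n
  proof (induction n)
    case (Suc n)
    have "map_prod (L ^^ Suc n) (L ^^ Suc n) v = map_prod L L (map_prod (L ^^ n) (L ^^ n) v)"
      by (simp add: uw)
    also have "\<dots> = complex_scale (z ^ n) (complex_scale z v)"
      by (simp only: Suc complex_scale_map_prod[OF L(1)] v(3))
    finally show ?case by (simp only: complex_scale_mult[symmetric] power_Suc2)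
  qed (simp add: uw)
  obtain C1 C2 where C: "\<And>n. norm ((L ^^ n) u) \<le> C1" "\<And>n. norm ((L' ^^ n) u) \<le> C1"
    "\<And>n. norm ((L ^^ n) w) \<le> C2" "\<And>n. norm ((L' ^^ n) w) \<le> C2"
    using v(2) by (auto simp: S_def uw)
  have bounded: "norm (map_prod (L ^^ n) (L ^^ n) v) \<le> C1 + C2" "norm (map_prod (L' ^^ n) (L' ^^ n) v) \<le> C1 + C2" for n
    using C[of n] norm_Pair_le[of "(L ^^ n) u" "(L ^^ n) w"] norm_Pair_le[of "(L' ^^ n) u" "(L' ^^ n) w"]
    by (auto simp: uw intro: order_trans add_mono)
  have nv: "norm v > 0" using v(1) by simp
  consider "cmod z > 1" | "cmod z < 1" using z by linarith
  then show False
  proof cases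
    case 1
    obtain n where "cmod z ^ n > (C1 + C2) / norm v" using real_arch_pow[OF 1] by blast
    then have "cmod z ^ n * norm v > C1 + C2" using nv by (simp add: field_simps)
    then show False using bounded(1)[of n] by (simp add: pow norm_complex_scale norm_power)
  next
    case 2
    have le: "norm v \<le> cmod z ^ n * (C1 + C2)" for n
    proof -
      have "v = map_prod (L' ^^ n) (L' ^^ n) (map_prod (L ^^ n) (L ^^ n) v)"
      proof -
        have "(L' ^^ n) ((L ^^ n) y) = y" for y
          by (induction n arbitrary: y) (auto simp: funpow_swap1 L(3))
        then show ?thesis by (simp add: uw)
      qed
      then have "v = complex_scale (z ^ n) (map_prod (L' ^^ n) (L' ^^ n) v)"
        by (simp add: pow complex_scale_map_prod[OF lin(2)])
      then have "norm v = cmod z ^ n * norm (map_prod (L' ^^ n) (L' ^^ n) v)"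
        by (metis norm_complex_scale norm_power)
      then show ?thesis using bounded(2)[of n] by (simp add: mult_left_mono)
    qed
    have "C1 + C2 > 0" using le[of 0] nv by (simp only: power_0 mult_1)
    then obtain n where "cmod z ^ n < norm v / (C1 + C2)"
      using real_arch_pow_inv[of "norm v / (C1 + C2)" "cmod z"] 2 nv by auto
    then show False using le[of n] \<open>C1 + C2 > 0\<close> by (simp add: field_simps)
  qed
qed

text \<open>By compactness of the unit sphere: a limit of unit vectors that fail for larger and larger \<open>N\<close> would have a
bounded two-sided orbit.\<close>

lemma uniform_linear_expansion:
  fixes L L' :: "'e::euclidean_space \<Rightarrow> 'e"
  assumes L: "linear L" "linear L'"
    and no_bounded: "\<And>x C. (\<And>n. norm ((L ^^ n) x) \<le> C) \<Longrightarrow> (\<And>n. norm ((L' ^^ n) x) \<le> C) \<Longrightarrow> x = 0"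
  shows "\<exists>N. \<forall>x. \<exists>n\<le>N. 2 * norm x \<le> norm ((L ^^ n) x) \<or> 2 * norm x \<le> norm ((L' ^^ n) x)"
proof (rule ccontr)
  assume "\<not> ?thesis"
  then obtain X where X: "\<And>N n. n \<le> N \<Longrightarrow> norm ((L ^^ n) (X N)) < 2 * norm (X N)"
    "\<And>N n. n \<le> N \<Longrightarrow> norm ((L' ^^ n) (X N)) < 2 * norm (X N)"
    by (metis not_le)
  have lin: "linear (L ^^ n)" "linear (L' ^^ n)" for n
    using L by (auto intro: linear_funpow)
  define Y where "Y N = X N /\<^sub>R norm (X N)" for N
  have nX: "norm (X N) > 0" for N using X(1)[of 0 N] by simp
  have Y: "norm (Y N) = 1" for N using nX[of N] by (simp add: Y_def)
  have LY: "norm ((L ^^ n) (Y N)) \<le> 2" "norm ((L' ^^ n) (Y N)) \<le> 2" if "n \<le> N" for n N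
    using X[OF that] nX[of N] by (simp_all add: Y_def lin[THEN linear_scale] field_simps)
  have "compact (sphere (0::'e) 1)" by simp
  moreover have "\<forall>n. Y n \<in> sphere 0 1" using Y by simp
  ultimately obtain y r where r: "y \<in> sphere 0 1" "strict_mono r" "(Y \<circ> r) \<longlonglongrightarrow> y"
    unfolding compact_def by blast
  have lim: "(\<lambda>j. Y (r j)) \<longlonglongrightarrow> y" using r(3) by (simp add: comp_def)
  have ev: "\<forall>\<^sub>F j in sequentially. n \<le> r j" for n
    by (rule eventually_subseq[OF r(2) eventually_ge_at_top])
  have "y = 0"
  proof (rule no_bounded)
    fix n
    have "(\<lambda>j. norm ((L ^^ n) (Y (r j)))) \<longlonglongrightarrow> norm ((L ^^ n) y)"
      by (intro tendsto_norm bounded_linear.tendsto[OF linear_conv_bounded_linear[THEN iffD1, OF lin(1)] lim])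
    then show "norm ((L ^^ n) y) \<le> 2"
      by (rule tendsto_upperbound) (use ev[of n] in \<open>auto elim!: eventually_mono intro: LY\<close>)
    have "(\<lambda>j. norm ((L' ^^ n) (Y (r j)))) \<longlonglongrightarrow> norm ((L' ^^ n) y)"
      by (intro tendsto_norm bounded_linear.tendsto[OF linear_conv_bounded_linear[THEN iffD1, OF lin(2)] lim])
    then show "norm ((L' ^^ n) y) \<le> 2"
      by (rule tendsto_upperbound) (use ev[of n] in \<open>auto elim!: eventually_mono intro: LY\<close>)
  qed
  then show False using r(1) by simp
qed

section \<open>Differentials in charts and isolation of hyperbolic points\<close>

text \<open>The differential of \<open>F\<close> at \<open>x\<close> in the coordinates of \<open>c\<close> and \<open>c'\<close>; for \<open>F = id\<close> it is the change of
coordinates.\<close>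

definition chart_derivative :: "('m \<Rightarrow> 'm) \<Rightarrow> ('m, 'e::euclidean_space) chart \<Rightarrow> ('m, 'e) chart \<Rightarrow> 'm \<Rightarrow> 'e \<Rightarrow> 'e" where
  "chart_derivative F c c' x = frechet_derivative (snd c' \<circ> F \<circ> chart_inv c) (at (snd c x))"

definition differentiable_map :: "('m::metric_space, 'e::euclidean_space) chart set \<Rightarrow> ('m \<Rightarrow> 'm) \<Rightarrow> bool" where
  "differentiable_map A F \<longleftrightarrow> continuous_on UNIV F \<and>
     (\<forall>c\<in>A. \<forall>c'\<in>A. \<forall>x\<in>fst c. F x \<in> fst c' \<longrightarrow>
        (snd c' \<circ> F \<circ> chart_inv c) differentiable (at (snd c x)))"

lemma chart_inv_left: "is_chart c \<Longrightarrow> x \<in> fst c \<Longrightarrow> chart_inv c (snd c x) = x"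
  by (auto simp: is_chart_def homeomorphism_def)

lemma Cr_on_imp_differentiable:
  assumes "1 \<le> r" "Cr_on r S g" "x \<in> S"
  shows "g differentiable (at x)"
proof -
  have "Ck_on (Suc 0) S g" using assms(1,2) by (auto simp: Cr_on_def one_enat_def)
  then show ?thesis using assms(3) by simp
qed

lemma C1_map_imp_differentiable_map:
  assumes "Cr_atlas r A" "C1_map A F"
  shows "differentiable_map A F"
  unfolding differentiable_map_def
proof (intro conjI ballI impI)
  show "continuous_on UNIV F" using assms(2) by (simp add: C1_map_def)
  fix c c' x assume *: "c \<in> A" "c' \<in> A" "x \<in> fst c" "F x \<in> fst c'"
  then show "(snd c' \<circ> F \<circ> chart_inv c) differentiable (at (snd c x))"
    using assms by (intro Cr_on_imp_differentiable[where r = 1 and S = "snd c ` (fst c \<inter> F -` fst c')"])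
      (auto simp: C1_map_def)
qed

text \<open>This is the differentiability of the transition maps, so that laws about changes of coordinates become
special cases of the chain rule for maps.\<close>

lemma differentiable_map_id:
  assumes "1 \<le> r" "Cr_atlas r A"
  shows "differentiable_map A id"
  unfolding differentiable_map_def
proof (intro conjI ballI impI)
  show "continuous_on UNIV (id :: 'a \<Rightarrow> 'a)" by (simp add: id_def)
  fix c c' x assume *: "c \<in> A" "c' \<in> A" "x \<in> fst c" "id x \<in> fst c'"
  then show "(snd c' \<circ> id \<circ> chart_inv c) differentiable (at (snd c x))"
    using assms by (intro Cr_on_imp_differentiable[OF assms(1), where S = "snd c ` (fst c \<inter> fst c')"])
      (auto simp: Cr_atlas_def transition_def)
qed

lemma chart_derivative:
  assumes "differentiable_map A F" "c \<in> A" "c' \<in> A" "x \<in> fst c" "F x \<in> fst c'"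
  shows "((snd c' \<circ> F \<circ> chart_inv c) has_derivative chart_derivative F c c' x) (at (snd c x))"
  using assms by (auto simp: differentiable_map_def chart_derivative_def frechet_derivative_works[symmetric])

lemma linear_chart_derivative:
  assumes "differentiable_map A F" "c \<in> A" "c' \<in> A" "x \<in> fst c" "F x \<in> fst c'"
  shows "linear (chart_derivative F c c' x)"
  using chart_derivative[OF assms] by (rule has_derivative_linear)

lemma open_chart_preimage:
  assumes "is_chart c" "open U"
  shows "open (snd c ` (fst c \<inter> U))"
proof -
  have hom: "homeomorphism (fst c) (snd c ` fst c) (snd c) (chart_inv c)" "open (fst c)" "open (snd c ` fst c)"
    using assms(1) by (auto simp: is_chart_def)
  have "snd c ` (fst c \<inter> U) = snd c ` fst c \<inter> chart_inv c -` U"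
    using chart_inv_left[OF assms(1)] by auto
  then show ?thesis
    using hom assms(2) by (auto intro!: continuous_open_preimage simp: homeomorphism_def)
qed

lemma has_derivative_comp_chart:
  assumes A: "\<forall>c\<in>A. is_chart c" and F: "differentiable_map A F" and G: "differentiable_map A G"
    and c: "c \<in> A" "c' \<in> A" "c'' \<in> A" "x \<in> fst c" "G x \<in> fst c'" "F (G x) \<in> fst c''"
  shows "((snd c'' \<circ> (F \<circ> G) \<circ> chart_inv c) has_derivative
      (chart_derivative F c' c'' (G x) \<circ> chart_derivative G c c' x)) (at (snd c x))"
proof -
  have chart: "is_chart c" "is_chart c'" using A c by auto
  have "((snd c'' \<circ> F \<circ> chart_inv c') \<circ> (snd c' \<circ> G \<circ> chart_inv c) has_derivative
      (chart_derivative F c' c'' (G x) \<circ> chart_derivative G c c' x)) (at (snd c x))"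
  proof (rule diff_chain_at)
    show "(snd c' \<circ> G \<circ> chart_inv c has_derivative chart_derivative G c c' x) (at (snd c x))"
      using chart_derivative[OF G c(1,2,4,5)] .
    have "(snd c' \<circ> G \<circ> chart_inv c) (snd c x) = snd c' (G x)"
      by (simp add: chart_inv_left[OF chart(1) c(4)])
    then show "(snd c'' \<circ> F \<circ> chart_inv c' has_derivative chart_derivative F c' c'' (G x))
        (at ((snd c' \<circ> G \<circ> chart_inv c) (snd c x)))"
      using chart_derivative[OF F c(2,3,5,6)] by simp
  qed
  then show ?thesis
  proof (rule has_derivative_transform_within_open)
    have "open (G -` fst c')"
      using G chart(2) by (auto simp: differentiable_map_def is_chart_def intro: open_vimage)
    then show "open (snd c ` (fst c \<inter> G -` fst c'))" by (rule open_chart_preimage[OF chart(1)])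
    show "snd c x \<in> snd c ` (fst c \<inter> G -` fst c')" using c by auto
    fix y assume "y \<in> snd c ` (fst c \<inter> G -` fst c')"
    then show "(snd c'' \<circ> F \<circ> chart_inv c' \<circ> (snd c' \<circ> G \<circ> chart_inv c)) y = (snd c'' \<circ> (F \<circ> G) \<circ> chart_inv c) y"
      by (auto simp: chart_inv_left[OF chart(1)] chart_inv_left[OF chart(2)])
  qed
qed

lemma chart_derivative_comp:
  assumes "\<forall>c\<in>A. is_chart c" "differentiable_map A F" "differentiable_map A G"
    "c \<in> A" "c' \<in> A" "c'' \<in> A" "x \<in> fst c" "G x \<in> fst c'" "F (G x) \<in> fst c''"
  shows "chart_derivative (F \<circ> G) c c'' x = chart_derivative F c' c'' (G x) \<circ> chart_derivative G c c' x"
  using has_derivative_comp_chart[OF assms] unfolding chart_derivative_def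
  by (simp add: frechet_derivative_at[symmetric])

lemma atlas_chart_at:
  assumes "Cr_atlas r A"
  obtains c where "c \<in> A" "x \<in> fst c" "is_chart c"
  using assms by (fastforce simp: Cr_atlas_def)

lemma chart_derivative_comp_apply:
  assumes "Cr_atlas r A" "differentiable_map A F" "differentiable_map A G"
    "c \<in> charts_at A x" "c' \<in> charts_at A (G x)" "c'' \<in> charts_at A (F (G x))"
  shows "chart_derivative (F \<circ> G) c c'' x b = chart_derivative F c' c'' (G x) (chart_derivative G c c' x b)"
proof -
  have "chart_derivative (F \<circ> G) c c'' x = chart_derivative F c' c'' (G x) \<circ> chart_derivative G c c' x"
    by (rule chart_derivative_comp[of A]) (use assms in \<open>simp_all add: Cr_atlas_def charts_at_def\<close>)
  then show ?thesis by simp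
qed

lemma chart_derivative_change_source:
  assumes A: "1 \<le> r" "Cr_atlas r A" and F: "differentiable_map A F"
    and "c \<in> charts_at A x" "c' \<in> charts_at A x" "c'' \<in> charts_at A (F x)"
  shows "chart_derivative F c' c'' x (chart_derivative id c c' x b) = chart_derivative F c c'' x b"
  using chart_derivative_comp_apply[OF A(2) F differentiable_map_id[OF A], of c x c' c'' b] assms by simp

lemma chart_derivative_change_target:
  assumes A: "1 \<le> r" "Cr_atlas r A" and F: "differentiable_map A F"
    and "c \<in> charts_at A x" "c' \<in> charts_at A (F x)" "c'' \<in> charts_at A (F x)"
  shows "chart_derivative id c' c'' (F x) (chart_derivative F c c' x b) = chart_derivative F c c'' x b"
  using chart_derivative_comp_apply[OF A(2) differentiable_map_id[OF A] F, of c x c' c'' b] assms by simp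

lemma differentiable_map_comp:
  assumes "Cr_atlas r A" "differentiable_map A F" "differentiable_map A G"
  shows "differentiable_map A (F \<circ> G)"
  unfolding differentiable_map_def
proof (intro conjI ballI impI)
  show "continuous_on UNIV (F \<circ> G)"
    using assms by (auto simp: differentiable_map_def o_def intro: continuous_on_compose2)
  fix c c'' x assume *: "c \<in> A" "c'' \<in> A" "x \<in> fst c" "(F \<circ> G) x \<in> fst c''"
  obtain c' where "c' \<in> A" "G x \<in> fst c'" using atlas_chart_at[OF assms(1)] .
  with has_derivative_comp_chart[of A F G c c' c'' x] * assms
  show "(snd c'' \<circ> (F \<circ> G) \<circ> chart_inv c) differentiable (at (snd c x))"
    by (auto simp: Cr_atlas_def differentiable_def)
qed

lemma differentiable_map_funpow:
  assumes "1 \<le> r" "Cr_atlas r A" "differentiable_map A F"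
  shows "differentiable_map A (F ^^ n)"
proof (induction n)
  case 0
  show ?case using differentiable_map_id[OF assms(1,2)] by (simp add: id_def)
next
  case (Suc n)
  then show ?case using differentiable_map_comp[OF assms(2,3) Suc] by (simp add: o_def)
qed

lemma chart_derivative_id:
  assumes "is_chart c" "x \<in> fst c"
  shows "chart_derivative id c c x = id"
proof -
  have "(id has_derivative id) (at (snd c x))" by (simp add: id_def)
  then have "((snd c \<circ> id \<circ> chart_inv c) has_derivative id) (at (snd c x))"
  proof (rule has_derivative_transform_within_open)
    show "open (snd c ` fst c)" using assms(1) by (simp add: is_chart_def)
    show "snd c x \<in> snd c ` fst c" using assms(2) by simp
    show "id y = (snd c \<circ> id \<circ> chart_inv c) y" if "y \<in> snd c ` fst c" for y
      using that by (auto simp: chart_inv_left[OF assms(1)])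
  qed
  then show ?thesis unfolding chart_derivative_def by (simp add: frechet_derivative_at[symmetric])
qed

lemma chart_derivative_funpow_fixed:
  assumes A: "1 \<le> r" "Cr_atlas r A" "differentiable_map A F" and c: "c \<in> A" "p \<in> fst c" "F p = p"
  shows "chart_derivative (F ^^ n) c c p = (chart_derivative F c c p) ^^ n"
proof (induction n)
  case 0
  have "is_chart c" using A c by (simp add: Cr_atlas_def)
  from chart_derivative_id[OF this c(2)] show ?case by (simp add: id_def)
next
  case (Suc n)
  have fix_n: "(F ^^ n) p = p" by (induction n) (auto simp: c(3))
  have "chart_derivative (F \<circ> F ^^ n) c c p b = chart_derivative F c c ((F ^^ n) p) (chart_derivative (F ^^ n) c c p b)" for b
    by (rule chart_derivative_comp_apply[OF A(2,3) differentiable_map_funpow[OF A]])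
      (use c fix_n in \<open>simp_all add: charts_at_def\<close>)
  then show ?case by (simp add: fix_n Suc fun_eq_iff o_def)
qed

lemma transition_derivative:
  "frechet_derivative (transition c c') (at (snd c x)) = chart_derivative id c c' x"
  by (simp add: chart_derivative_def transition_def)

lemma coord_vector_in_tangent_space:
  assumes "1 \<le> r" "Cr_atlas r A" "c \<in> charts_at A x"
  shows "coord_vector A c x b \<in> tangent_space A x"
proof -
  have "chart_derivative id c1 c2 x (chart_derivative id c c1 x b) = chart_derivative id c c2 x b"
    if "c1 \<in> charts_at A x" "c2 \<in> charts_at A x" for c1 c2
    using chart_derivative_change_source[OF assms(1,2) differentiable_map_id[OF assms(1,2)] assms(3), of c1 c2 b] that
    by simp
  then show ?thesis
    by (auto simp: tangent_space_def coord_vector_def transition_derivative)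
qed

lemma coord_vector_of_tangent:
  assumes "v \<in> tangent_space A x" "c \<in> charts_at A x"
  shows "coord_vector A c x (v c) = v"
proof
  fix c'
  have "v c' = frechet_derivative (transition c c') (at (snd c x)) (v c)" if "c' \<in> charts_at A x"
    using assms that unfolding tangent_space_def by blast
  moreover have "v c' = 0" if "c' \<notin> charts_at A x"
    using assms(1) that unfolding tangent_space_def by blast
  ultimately show "coord_vector A c x (v c) c' = v c'" by (simp only: coord_vector_def split: if_split) simp
qed

lemma coord_vector_chart:
  assumes "Cr_atlas r A" "c \<in> charts_at A x"
  shows "coord_vector A c x b c = b"
  using assms chart_derivative_id[of c x]
  by (simp add: coord_vector_def transition_derivative Cr_atlas_def charts_at_def)

text \<open>The differential of a map is defined by means of one chart around \<open>x\<close>; by the chain rule its coordinate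
expression is the expected one in every pair of charts.\<close>

lemma differential_coord_vector:
  assumes A: "1 \<le> r" "Cr_atlas r A" and F: "differentiable_map A F"
    and c: "c \<in> charts_at A x" "c' \<in> charts_at A (F x)"
  shows "differential A F x (coord_vector A c x b) = coord_vector A c' (F x) (chart_derivative F c c' x b)"
proof
  fix c''
  define c0 where "c0 = (SOME c. c \<in> charts_at A x)"
  have c0: "c0 \<in> charts_at A x" unfolding c0_def using c(1) by (rule someI)
  show "differential A F x (coord_vector A c x b) c'' = coord_vector A c' (F x) (chart_derivative F c c' x b) c''"
  proof (cases "c'' \<in> charts_at A (F x)")
    case True
    have "differential A F x (coord_vector A c x b) c'' =
        chart_derivative F c0 c'' x (chart_derivative id c c0 x b)"
      using True c0 by (simp add: differential_def coord_vector_def Let_def c0_def[symmetric]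
          transition_derivative chart_derivative_def[of F])
    also have "\<dots> = chart_derivative F c c'' x b"
      using chart_derivative_change_source[OF A F c(1) c0 True] .
    also have "\<dots> = chart_derivative id c' c'' (F x) (chart_derivative F c c' x b)"
      using chart_derivative_change_target[OF A F c True] by simp
    finally show ?thesis using True by (simp add: coord_vector_def transition_derivative)
  qed (simp add: differential_def coord_vector_def Let_def)
qed

definition coord_form :: "('m::metric_space, 'e::euclidean_space) chart set \<Rightarrow>
    ('m \<Rightarrow> ('m, 'e) tangent list \<Rightarrow> real) \<Rightarrow> ('m, 'e) chart \<Rightarrow> 'm \<Rightarrow> 'e list \<Rightarrow> real" where
  "coord_form A \<omega> c x bs = \<omega> x (map (coord_vector A c x) bs)"

lemma coord_form_preserved:
  assumes A: "1 \<le> r" "Cr_atlas r A" and F: "differentiable_map A F" and \<omega>: "preserves_form A F \<omega>"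
    and c: "c \<in> charts_at A x" "c' \<in> charts_at A (F x)" and bs: "length bs = DIM('e)"
  shows "coord_form A \<omega> c' (F x) (map (chart_derivative F c c' x) bs) =
    coord_form A \<omega> c x (bs :: 'e::euclidean_space list)"
proof -
  have "set (map (coord_vector A c x) bs) \<subseteq> tangent_space A x"
    using coord_vector_in_tangent_space[OF A c(1)] by auto
  then have "\<omega> (F x) (map (differential A F x) (map (coord_vector A c x) bs)) = \<omega> x (map (coord_vector A c x) bs)"
    using \<omega> bs unfolding preserves_form_def by (metis length_map)
  then show ?thesis
    by (simp add: coord_form_def comp_def differential_coord_vector[OF A F c])
qed

lemma coord_form_funpow:
  assumes A: "1 \<le> r" "Cr_atlas r A" and F: "differentiable_map A F" and \<omega>: "preserves_form A F \<omega>"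
    and c: "c \<in> charts_at A x" "c' \<in> charts_at A ((F ^^ n) x)" and bs: "length bs = DIM('e)"
  shows "coord_form A \<omega> c' ((F ^^ n) x) (map (chart_derivative (F ^^ n) c c' x) bs) =
    coord_form A \<omega> c x (bs :: 'e::euclidean_space list)"
  using c(2)
proof (induction n arbitrary: c')
  case 0
  have id: "preserves_form A id \<omega>"
  proof -
    have "map (differential A id y) vs = vs" if "set vs \<subseteq> tangent_space A y" for y and vs :: "('a, 'e) tangent list"
    proof (rule map_idI)
      fix v assume "v \<in> set vs"
      then have v: "v \<in> tangent_space A y" using that by auto
      obtain c where "c \<in> A" "y \<in> fst c" using atlas_chart_at[OF A(2)] .
      then have c: "c \<in> charts_at A y" by (simp add: charts_at_def)
      have "is_chart c" "y \<in> fst c" using c A by (auto simp: charts_at_def Cr_atlas_def)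
      then show "differential A id y v = v"
        using differential_coord_vector[OF A differentiable_map_id[OF A] c, of c "v c"] c
        by (simp add: coord_vector_of_tangent[OF v c] chart_derivative_id)
    qed
    then show ?thesis by (simp add: preserves_form_def)
  qed
  show ?case using coord_form_preserved[OF A differentiable_map_id[OF A] id c(1) _ bs, of c'] 0
    by (simp add: id_def)
next
  case (Suc n)
  obtain c1 where c1: "c1 \<in> A" "(F ^^ n) x \<in> fst c1" using atlas_chart_at[OF A(2)] .
  then have c1': "c1 \<in> charts_at A ((F ^^ n) x)" by (simp add: charts_at_def)
  have "chart_derivative (F \<circ> F ^^ n) c c' x b = chart_derivative F c1 c' ((F ^^ n) x) (chart_derivative (F ^^ n) c c1 x b)" for b
    by (rule chart_derivative_comp_apply[OF A(2) F differentiable_map_funpow[OF A F] c(1) c1']) (use Suc.prems in simp)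
  then have eq: "map (chart_derivative (F ^^ Suc n) c c' x) bs =
      map (chart_derivative F c1 c' ((F ^^ n) x)) (map (chart_derivative (F ^^ n) c c1 x) bs)"
    by (simp add: o_def)
  have "coord_form A \<omega> c' (F ((F ^^ n) x))
      (map (chart_derivative F c1 c' ((F ^^ n) x)) (map (chart_derivative (F ^^ n) c c1 x) bs)) =
    coord_form A \<omega> c1 ((F ^^ n) x) (map (chart_derivative (F ^^ n) c c1 x) bs)"
    by (rule coord_form_preserved[OF A F \<omega> c1']) (use Suc.prems bs in simp_all)
  also have "\<dots> = coord_form A \<omega> c x bs" by (rule Suc.IH[OF c1'])
  finally show ?case unfolding eq by simp
qed

text \<open>For some \<open>N\<close>, every vector is at least doubled by one of \<open>L\<^sup>n\<close>, \<open>L\<^sup>-\<^sup>n\<close> with \<open>n \<le> N\<close>, where \<open>L\<close> is the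
differential at \<open>p\<close>. Near \<open>p\<close> these finitely many powers of \<open>g\<close> agree with their differentials up
to a small relative error, so the distance to \<open>p\<close>, measured in a chart, grows by the factor \<open>3/2\<close>
under one of them. On an orbit that stays near \<open>p\<close>, the supremum of these distances is therefore \<open>0\<close>.\<close>

lemma hyperbolic_imp_isolated:
  fixes A :: "('m::metric_space, 'e::euclidean_space) chart set"
  assumes A: "1 \<le> r" "Cr_atlas r A" and g: "bij g" "differentiable_map A g" "differentiable_map A (inv g)"
    and p: "g p = p"
    and ev: "\<And>z. complex_eigenvalue (tangent_space A p) (differential A g p) z \<Longrightarrow> cmod z \<noteq> 1"
  shows "\<exists>e>0. \<forall>y. (\<forall>n. dist ((g ^^ n) y) p \<le> e) \<longrightarrow> (\<forall>n. dist ((inv g ^^ n) y) p \<le> e) \<longrightarrow> y = p"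
proof -
  obtain c where c: "c \<in> A" "p \<in> fst c" "is_chart c" using atlas_chart_at[OF A(2)] .
  then have cp: "c \<in> charts_at A p" by (simp add: charts_at_def)
  have inv_p: "inv g p = p" using p g(1) by (metis bij_inv_eq_iff)
  define L where "L = chart_derivative g c c p"
  define L' where "L' = chart_derivative (inv g) c c p"
  have lin: "linear L" "linear L'"
    unfolding L_def L'_def using g c p inv_p by (auto intro!: linear_chart_derivative)
  have gg: "inv g \<circ> g = id" "g \<circ> inv g = id"
    using g(1) by (auto simp: bij_is_inj bij_is_surj surj_iff[symmetric])
  have L'L: "L' (L x) = x" for x
    using chart_derivative_comp_apply[OF A(2) g(3,2) cp, of c c x] cp p inv_p chart_derivative_id[OF c(3,2)]
    unfolding L_def L'_def gg by simp
  have LL': "L (L' x) = x" for x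
    using chart_derivative_comp_apply[OF A(2) g(2,3) cp, of c c x] cp p inv_p chart_derivative_id[OF c(3,2)]
    unfolding L_def L'_def gg by simp
  have no_ev: "cmod z \<noteq> 1"
    if "u \<noteq> 0 \<or> w \<noteq> 0" "L u = Re z *\<^sub>R u - Im z *\<^sub>R w" "L w = Im z *\<^sub>R u + Re z *\<^sub>R w" for z u w
  proof (rule ev)
    have lin_id: "linear (chart_derivative id c c' p)" if "c' \<in> charts_at A p" for c'
      using that c differentiable_map_id[OF A] by (auto intro!: linear_chart_derivative simp: charts_at_def)
    have comb: "coord_vector A c p (a *\<^sub>R u + b *\<^sub>R w) = (\<lambda>c'. a *\<^sub>R coord_vector A c p u c' + b *\<^sub>R coord_vector A c p w c')" for a b
      using lin_id by (auto simp: coord_vector_def transition_derivative linear_add linear_scale)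
    have diff: "differential A g p (coord_vector A c p b) = coord_vector A c p (L b)" for b
      using differential_coord_vector[OF A g(2) cp, of c b] cp p by (simp add: L_def)
    show "complex_eigenvalue (tangent_space A p) (differential A g p) z"
      unfolding complex_eigenvalue_def
    proof (intro bexI conjI)
      show "coord_vector A c p u \<noteq> (\<lambda>_. 0) \<or> coord_vector A c p w \<noteq> (\<lambda>_. 0)"
        using that(1) coord_vector_chart[OF A(2) cp, of u] coord_vector_chart[OF A(2) cp, of w] by metis
      show "differential A g p (coord_vector A c p u) =
          (\<lambda>c'. Re z *\<^sub>R coord_vector A c p u c' - Im z *\<^sub>R coord_vector A c p w c')"
        using comb[of "Re z" "- Im z"] by (simp add: diff that(2))
      show "differential A g p (coord_vector A c p w) =
          (\<lambda>c'. Im z *\<^sub>R coord_vector A c p u c' + Re z *\<^sub>R coord_vector A c p w c')"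
        using comb[of "Im z" "Re z"] by (simp add: diff that(3))
    qed (use coord_vector_in_tangent_space[OF A cp] in auto)
  qed
  have "\<exists>N. \<forall>x. \<exists>n\<le>N. 2 * norm x \<le> norm ((L ^^ n) x) \<or> 2 * norm x \<le> norm ((L' ^^ n) x)"
    by (rule uniform_linear_expansion[OF lin]) (rule bounded_orbit_eq_0[OF lin L'L LL' no_ev])
  then obtain N where N: "\<And>x. \<exists>n\<le>N. 2 * norm x \<le> norm ((L ^^ n) x) \<or> 2 * norm x \<le> norm ((L' ^^ n) x)"
    by blast
  define d where "d x = norm (snd c x - snd c p)" for x
  have near_chart: "\<forall>\<^sub>F x in nhds p. dist (snd c x) (snd c p) < \<delta>" if "\<delta> > 0" for \<delta>
  proof -
    have "continuous_on (fst c) (snd c)" "open (fst c)"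
      using c(3) by (auto simp: is_chart_def homeomorphism_def)
    then have "continuous (at p) (snd c)" using c(2) by (simp add: continuous_on_eq_continuous_at)
    then show ?thesis using that unfolding continuous_at_eps_delta eventually_nhds_metric by blast
  qed
  have approx: "\<forall>\<^sub>F x in nhds p. norm (snd c ((h ^^ n) x) - snd c p - (T ^^ n) (snd c x - snd c p)) \<le> 1/2 * d x"
    if h: "differentiable_map A h" "h p = p" and T: "T = chart_derivative h c c p" for h T n
  proof -
    have hn: "(h ^^ n) p = p" by (induction n) (auto simp: h(2))
    have "((snd c \<circ> h ^^ n \<circ> chart_inv c) has_derivative (T ^^ n)) (at (snd c p))"
      using chart_derivative[OF differentiable_map_funpow[OF A h(1)] c(1,1,2), of n] hn c(2)
      unfolding chart_derivative_funpow_fixed[OF A h(1) c(1,2) h(2)] T by simp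
    then obtain \<delta> where \<delta>: "\<delta> > 0" "\<And>y. norm (y - snd c p) < \<delta> \<Longrightarrow>
        norm ((snd c \<circ> h ^^ n \<circ> chart_inv c) y - (snd c \<circ> h ^^ n \<circ> chart_inv c) (snd c p) - (T ^^ n) (y - snd c p))
          \<le> 1/2 * norm (y - snd c p)"
      unfolding has_derivative_at_alt by (meson half_gt_zero zero_less_one)
    have "\<forall>\<^sub>F x in nhds p. dist (snd c x) (snd c p) < \<delta>" using \<delta>(1) by (rule near_chart)
    moreover have "\<forall>\<^sub>F x in nhds p. x \<in> fst c"
      using c by (auto simp: is_chart_def intro: eventually_nhds_in_open)
    ultimately show ?thesis
    proof eventually_elim
      case (elim x)
      then show ?case using \<delta>(2)[of "snd c x"]
        by (simp add: chart_inv_left[OF c(3)] c(2) hn d_def dist_norm)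
    qed
  qed
  have "\<forall>\<^sub>F x in nhds p. x \<in> fst c \<and> d x < 1 \<and> (\<forall>n\<in>{..N}.
      norm (snd c ((g ^^ n) x) - snd c p - (L ^^ n) (snd c x - snd c p)) \<le> 1/2 * d x \<and>
      norm (snd c ((inv g ^^ n) x) - snd c p - (L' ^^ n) (snd c x - snd c p)) \<le> 1/2 * d x)"
  proof (intro eventually_conj eventually_ball_finite ballI)
    show "\<forall>\<^sub>F x in nhds p. x \<in> fst c"
      using c by (auto simp: is_chart_def intro: eventually_nhds_in_open)
    show "\<forall>\<^sub>F x in nhds p. d x < 1" using near_chart[of 1] by (simp add: d_def dist_norm)
  qed (use approx[OF g(2) p L_def] approx[OF g(3) inv_p L'_def] in auto)
  then obtain e0 where e0: "e0 > 0" and near: "\<And>x. dist x p < e0 \<Longrightarrow> x \<in> fst c \<and> d x < 1 \<and> (\<forall>n\<in>{..N}.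
      norm (snd c ((g ^^ n) x) - snd c p - (L ^^ n) (snd c x - snd c p)) \<le> 1/2 * d x \<and>
      norm (snd c ((inv g ^^ n) x) - snd c p - (L' ^^ n) (snd c x - snd c p)) \<le> 1/2 * d x)"
    unfolding eventually_nhds_metric by auto
  have expand: "\<exists>n\<le>N. 3/2 * d x \<le> d ((g ^^ n) x) \<or> 3/2 * d x \<le> d ((inv g ^^ n) x)" if x: "dist x p < e0" for x
  proof -
    obtain n where n: "n \<le> N"
      "2 * d x \<le> norm ((L ^^ n) (snd c x - snd c p)) \<or> 2 * d x \<le> norm ((L' ^^ n) (snd c x - snd c p))"
      using N[of "snd c x - snd c p"] by (auto simp: d_def)
    have triangle: "norm v - norm u \<le> 1/2 * d x" if "norm (u - v) \<le> 1/2 * d x" for u v :: 'e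
      using that norm_triangle_ineq2[of v u] by (simp add: norm_minus_commute)
    have "norm ((L ^^ n) (snd c x - snd c p)) - d ((g ^^ n) x) \<le> 1/2 * d x"
      unfolding d_def[of "(g ^^ n) x"] by (rule triangle) (use near[OF x] n(1) in blast)
    moreover have "norm ((L' ^^ n) (snd c x - snd c p)) - d ((inv g ^^ n) x) \<le> 1/2 * d x"
      unfolding d_def[of "(inv g ^^ n) x"] by (rule triangle) (use near[OF x] n(1) in blast)
    ultimately show ?thesis using n by force
  qed
  have "y = p" if y: "\<And>n. dist ((g ^^ n) y) p \<le> e0 / 2" "\<And>n. dist ((inv g ^^ n) y) p \<le> e0 / 2" for y
  proof -
    define Y where "Y i = iterate g i y" for i
    have Y: "dist (Y i) p < e0" for i
      using y[of "nat i"] y[of "nat (- i)"] e0 by (auto simp: Y_def iterate_def)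
    define s where "s = (SUP i. d (Y i))"
    have bdd: "bdd_above (range (\<lambda>i. d (Y i)))"
      using near[OF Y] by (intro bdd_aboveI[of _ 1]) (auto intro: less_imp_le)
    have le_s: "d (Y i) \<le> s" for i unfolding s_def using bdd by (intro cSUP_upper) auto
    have "s \<le> 0"
    proof (rule ccontr)
      assume "\<not> s \<le> 0"
      then have "2/3 * s < s" by simp
      then obtain i where i: "2/3 * s < d (Y i)"
        using less_cSUP_iff[OF UNIV_not_empty bdd, of "2/3 * s"] unfolding s_def[symmetric] by blast
      obtain n where "3/2 * d (Y i) \<le> d ((g ^^ n) (Y i)) \<or> 3/2 * d (Y i) \<le> d ((inv g ^^ n) (Y i))"
        using expand[OF Y] by blast
      moreover have "(g ^^ n) (Y i) = Y (int n + i)"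
        by (simp only: Y_def iterate_add[OF g(1)] iterate_of_nat)
      moreover have "(inv g ^^ n) (Y i) = Y (- int n + i)"
        by (simp only: Y_def iterate_add[OF g(1)] iterate_minus_of_nat)
      ultimately show False using i le_s[of "int n + i"] le_s[of "- int n + i"] by auto
    qed
    then have "d y \<le> 0" using le_s[of 0] by (simp add: Y_def iterate_def)
    then have "snd c y = snd c p" by (simp add: d_def)
    then show "y = p" using chart_inv_left[OF c(3), of y] chart_inv_left[OF c(3,2)] near[OF Y, of 0]
      by (simp add: Y_def iterate_def)
  qed
  then show ?thesis using e0 by (intro exI[of _ "e0 / 2"]) auto
qed

section \<open>Alternating forms and determinants in Euclidean coordinates\<close>

text \<open>Change of variables is formulated for \<open>real ^ 'n\<close>, whose index type carries a well-order. This index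
type of size \<open>DIM('e)\<close> makes a copy of any Euclidean space \<open>'e\<close> of that form.\<close>

typedef (overloaded) ('e::euclidean_space) basis_index = "{..<DIM('e)}"
  by (rule exI[of _ 0]) simp

instantiation basis_index :: (euclidean_space) wellorder
begin

definition less_eq_basis_index :: "'a basis_index \<Rightarrow> 'a basis_index \<Rightarrow> bool" where
  "i \<le> j \<longleftrightarrow> Rep_basis_index i \<le> Rep_basis_index j"

definition less_basis_index :: "'a basis_index \<Rightarrow> 'a basis_index \<Rightarrow> bool" where
  "i < j \<longleftrightarrow> Rep_basis_index i < Rep_basis_index j"

instance
proof
  fix P :: "'a basis_index \<Rightarrow> bool" and a
  assume step: "\<And>x. (\<And>y. y < x \<Longrightarrow> P y) \<Longrightarrow> P x"
  show "P a"
    by (induction a rule: measure_induct_rule[of Rep_basis_index]) (auto simp: less_basis_index_def intro: step)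
qed (auto simp: less_eq_basis_index_def less_basis_index_def Rep_basis_index_inject)

end

instance basis_index :: (euclidean_space) finite
proof
  have "(UNIV :: 'a basis_index set) = Abs_basis_index ` {..<DIM('a)}"
    by (metis type_definition.Abs_image type_definition_basis_index)
  then show "finite (UNIV :: 'a basis_index set)" by (metis finite_imageI finite_lessThan)
qed

definition basis_list :: "'e::euclidean_space list" where
  "basis_list = (SOME bs. distinct bs \<and> set bs = Basis)"

lemma basis_list: "distinct (basis_list :: 'e::euclidean_space list)" "set (basis_list :: 'e list) = Basis"
  and length_basis_list: "length (basis_list :: 'e list) = DIM('e)"
proof -
  have "\<exists>bs :: 'e list. distinct bs \<and> set bs = Basis" using finite_distinct_list[OF finite_Basis] by blast
  then have "distinct (basis_list :: 'e list) \<and> set (basis_list :: 'e list) = Basis"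
    unfolding basis_list_def by (rule someI_ex)
  then show "distinct (basis_list :: 'e list)" "set (basis_list :: 'e list) = Basis"
    "length (basis_list :: 'e list) = DIM('e)" by (auto simp flip: distinct_card)
qed

definition basis_vector :: "'e::euclidean_space basis_index \<Rightarrow> 'e" where
  "basis_vector i = basis_list ! Rep_basis_index i"

lemma bij_basis_vector: "bij_betw (basis_vector :: 'e::euclidean_space basis_index \<Rightarrow> 'e) UNIV Basis"
proof -
  have "bij_betw Rep_basis_index (UNIV :: 'e basis_index set) {..<DIM('e)}"
    using type_definition.Rep_range[OF type_definition_basis_index]
    by (auto simp: bij_betw_def inj_on_def Rep_basis_index_inject)
  moreover have "bij_betw ((!) (basis_list :: 'e list)) {..<DIM('e)} Basis"
    by (rule bij_betw_nth) (auto simp: basis_list length_basis_list)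
  ultimately have "bij_betw ((!) (basis_list :: 'e list) \<circ> Rep_basis_index) (UNIV :: 'e basis_index set) Basis"
    by (rule bij_betw_trans)
  then show ?thesis by (simp add: basis_vector_def[abs_def] o_def)
qed

definition to_vec :: "'e::euclidean_space \<Rightarrow> real ^ 'e basis_index" where
  "to_vec x = (\<chi> i. x \<bullet> basis_vector i)"

definition of_vec :: "real ^ ('e::euclidean_space) basis_index \<Rightarrow> 'e" where
  "of_vec v = (\<Sum>i\<in>UNIV. v $ i *\<^sub>R basis_vector i)"

lemma linear_to_vec: "linear to_vec" and linear_of_vec: "linear of_vec"
  by (auto simp: linear_iff to_vec_def of_vec_def vec_eq_iff inner_add_left scaleR_add_left sum.distrib scaleR_sum_right)

lemma of_vec_to_vec [simp]: "of_vec (to_vec x) = x"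
  using sum.reindex_bij_betw[OF bij_basis_vector, of "\<lambda>b. (x \<bullet> b) *\<^sub>R b"]
  by (simp add: of_vec_def to_vec_def euclidean_representation)

lemma to_vec_of_vec [simp]: "to_vec (of_vec v) = v"
proof -
  have ortho: "basis_vector i \<bullet> basis_vector j = (if i = j then 1 else 0)" for i j :: "'a basis_index"
  proof -
    have "basis_vector i \<in> Basis" "basis_vector j \<in> Basis" "basis_vector i = basis_vector j \<longleftrightarrow> i = j"
      using bij_basis_vector by (auto simp: bij_betw_def inj_on_def)
    then show ?thesis by (simp add: inner_Basis)
  qed
  show ?thesis
    by (simp add: vec_eq_iff to_vec_def of_vec_def inner_sum_left ortho if_distrib cong: if_cong)
qed

definition alternating_multilinear :: "(('n \<Rightarrow> 'v::real_vector) \<Rightarrow> real) \<Rightarrow> bool" where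
  "alternating_multilinear \<gamma> \<longleftrightarrow>
     (\<forall>h i u w a b. \<gamma> (h(i := a *\<^sub>R u + b *\<^sub>R w)) = a * \<gamma> (h(i := u)) + b * \<gamma> (h(i := w))) \<and>
     (\<forall>h i j. i \<noteq> j \<longrightarrow> h i = h j \<longrightarrow> \<gamma> h = 0)"

lemma alternating_multilinearD:
  assumes "alternating_multilinear \<gamma>"
  shows "\<gamma> (h(i := a *\<^sub>R u + b *\<^sub>R w)) = a * \<gamma> (h(i := u)) + b * \<gamma> (h(i := w))"
    and "\<gamma> (h(i := u + w)) = \<gamma> (h(i := u)) + \<gamma> (h(i := w))"
    and "\<gamma> (h(i := a *\<^sub>R u)) = a * \<gamma> (h(i := u))"
    and "\<gamma> (h(i := 0)) = 0"
    and "i \<noteq> j \<Longrightarrow> h i = h j \<Longrightarrow> \<gamma> h = 0"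
proof -
  have lin: "\<gamma> (h(i := a *\<^sub>R u + b *\<^sub>R w)) = a * \<gamma> (h(i := u)) + b * \<gamma> (h(i := w))" for a b u w
    using assms unfolding alternating_multilinear_def by blast
  then show "\<gamma> (h(i := a *\<^sub>R u + b *\<^sub>R w)) = a * \<gamma> (h(i := u)) + b * \<gamma> (h(i := w))" .
  show "\<gamma> (h(i := u + w)) = \<gamma> (h(i := u)) + \<gamma> (h(i := w))" using lin[of 1 u 1 w] by simp
  show "\<gamma> (h(i := a *\<^sub>R u)) = a * \<gamma> (h(i := u))" using lin[of a u 0 u] by simp
  show "\<gamma> (h(i := 0)) = 0" using lin[of 0 u 0 u] by simp
  show "i \<noteq> j \<Longrightarrow> h i = h j \<Longrightarrow> \<gamma> h = 0" using assms unfolding alternating_multilinear_def by blast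
qed

lemma alternating_multilinear_det: "alternating_multilinear (\<lambda>h :: 'n::finite \<Rightarrow> real ^ 'n. det (\<chi> i. h i))"
proof -
  have "det (\<chi> k. (h(i := a *\<^sub>R u + b *\<^sub>R w)) k) = a * det (\<chi> k. (h(i := u)) k) + b * det (\<chi> k. (h(i := w)) k)"
    for h :: "'n \<Rightarrow> real ^ 'n" and i a b u w
  proof -
    have upd: "(\<chi> k. (h(i := v)) k) = (\<chi> k. if k = i then v else h k)" for v by (simp add: vec_eq_iff)
    show ?thesis
      unfolding upd det_row_add det_row_mul[of i "a" "\<lambda>_. u" h, unfolded scalar_mult_eq_scaleR]
        det_row_mul[of i "b" "\<lambda>_. w" h, unfolded scalar_mult_eq_scaleR] ..
  qed
  moreover have "det (\<chi> k. h k) = 0" if "i \<noteq> j" "h i = h j" for h :: "'n \<Rightarrow> real ^ 'n" and i j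
    using that by (intro det_identical_rows[of i j]) (auto simp: row_def vec_eq_iff)
  ultimately show ?thesis unfolding alternating_multilinear_def by blast
qed

lemma alternating_multilinear_compose:
  assumes "alternating_multilinear \<gamma>" "linear f"
  shows "alternating_multilinear (\<lambda>h. \<gamma> (\<lambda>i. f (h i)))"
proof -
  have upd: "(\<lambda>k. f ((h(i := v)) k)) = (\<lambda>k. f (h k))(i := f v)" for h i v by auto
  show ?thesis
    unfolding alternating_multilinear_def upd linear_add[OF assms(2)] linear_scale[OF assms(2)]
    using alternating_multilinearD[OF assms(1)] by (metis (no_types, lifting))
qed

lemma alternating_multilinear_sum:
  assumes \<gamma>: "alternating_multilinear \<gamma>" and "finite J"
  shows "\<gamma> (h(i := (\<Sum>j\<in>J. c j *\<^sub>R v j))) = (\<Sum>j\<in>J. c j * \<gamma> (h(i := v j)))"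
  using assms(2) by (induction J) (simp_all add: alternating_multilinearD(2-4)[OF \<gamma>] del: fun_upd_apply)

text \<open>One of the vectors is a combination of the others, and substituting it leaves only terms with a
repeated argument.\<close>

lemma alternating_multilinear_dependent:
  fixes f :: "real ^ 'n \<Rightarrow> 'v::real_vector"
  assumes \<gamma>: "alternating_multilinear \<gamma>" and f: "linear f" and v: "f v = 0" "v \<noteq> 0"
  shows "\<gamma> (\<lambda>i. f (axis i 1)) = 0"
proof -
  obtain k where k: "v $ k \<noteq> 0" using v(2) by (auto simp: vec_eq_iff)
  define h where "h = (\<lambda>i. f (axis i 1))"
  have "(\<Sum>i\<in>UNIV. v $ i *\<^sub>R axis i 1) = v"
    using basis_expansion[of v] by (simp add: scalar_mult_eq_scaleR)
  moreover have "f (\<Sum>i\<in>UNIV. v $ i *\<^sub>R axis i 1) = (\<Sum>i\<in>UNIV. v $ i *\<^sub>R h i)"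
    by (simp add: h_def linear_sum[OF f] linear_scale[OF f])
  ultimately have "f v = (\<Sum>i\<in>UNIV. v $ i *\<^sub>R h i)" by simp
  then have "v $ k *\<^sub>R h k + (\<Sum>i\<in>UNIV - {k}. v $ i *\<^sub>R h i) = 0"
    using v(1) by (simp add: sum.remove[of UNIV k])
  then have "v $ k *\<^sub>R h k = (\<Sum>i\<in>UNIV - {k}. - v $ i *\<^sub>R h i)"
    by (simp add: sum_negf eq_neg_iff_add_eq_0)
  then have "(1 / v $ k) *\<^sub>R v $ k *\<^sub>R h k = (\<Sum>i\<in>UNIV - {k}. (1 / v $ k) *\<^sub>R (- v $ i *\<^sub>R h i))"
    by (simp only: scaleR_sum_right)
  then have "h k = (\<Sum>i\<in>UNIV - {k}. (- v $ i / v $ k) *\<^sub>R h i)" using k by simp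
  then have "\<gamma> h = \<gamma> (h(k := (\<Sum>i\<in>UNIV - {k}. (- v $ i / v $ k) *\<^sub>R h i)))"
    by (metis fun_upd_triv)
  also have "\<dots> = (\<Sum>i\<in>UNIV - {k}. (- v $ i / v $ k) * \<gamma> (h(k := h i)))"
    by (rule alternating_multilinear_sum[OF \<gamma>]) simp
  also have "\<dots> = 0"
  proof (rule sum.neutral, rule ballI)
    fix i assume "i \<in> UNIV - {k}"
    then have "\<gamma> (h(k := h i)) = 0"
      using alternating_multilinearD(5)[OF \<gamma>, of k i "h(k := h i)"] by auto
    then show "- v $ i / v $ k * \<gamma> (h(k := h i)) = 0" by simp
  qed
  finally show ?thesis by (simp add: h_def)
qed

text \<open>Expand the value with \<open>h m + h n\<close> at both places, which is \<open>0\<close>.\<close>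

lemma alternating_multilinear_swap:
  assumes \<gamma>: "alternating_multilinear \<gamma>" and "m \<noteq> n"
  shows "\<gamma> (h(m := h n, n := h m)) = - \<gamma> h"
proof -
  have "0 = \<gamma> (h(m := h m + h n, n := h m + h n))"
    using alternating_multilinearD(5)[OF \<gamma> assms(2), of "h(m := h m + h n, n := h m + h n)"] assms(2) by simp
  also have "\<dots> = \<gamma> (h(m := h m + h n, n := h m)) + \<gamma> (h(m := h m + h n, n := h n))"
    by (rule alternating_multilinearD(2)[OF \<gamma>])
  also have "\<gamma> (h(m := h m + h n, n := h m)) = \<gamma> (h(n := h m, m := h m)) + \<gamma> (h(n := h m, m := h n))"
    using alternating_multilinearD(2)[OF \<gamma>, of "h(n := h m)" m] assms(2) by (simp add: fun_upd_twist)
  also have "\<gamma> (h(m := h m + h n, n := h n)) = \<gamma> (h(n := h n, m := h m)) + \<gamma> (h(n := h n, m := h n))"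
    using alternating_multilinearD(2)[OF \<gamma>, of "h(n := h n)" m] assms(2) by (simp add: fun_upd_twist)
  also have "\<gamma> (h(n := h m, m := h m)) = 0"
    by (rule alternating_multilinearD(5)[OF \<gamma> assms(2)]) simp
  also have "\<gamma> (h(n := h n, m := h n)) = 0"
    by (rule alternating_multilinearD(5)[OF \<gamma> assms(2)]) (use assms(2) in simp)
  finally show ?thesis using assms(2) by (simp add: fun_upd_twist del: fun_upd_apply)
qed

lemma alternating_multilinear_scale:
  assumes \<gamma>: "alternating_multilinear \<gamma>" and "finite J"
  shows "\<gamma> (\<lambda>i. if i \<in> J then c i *\<^sub>R h i else h i) = (\<Prod>i\<in>J. c i) * \<gamma> h"
  using assms(2)
proof (induction J)
  case (insert k J)
  define h' where "h' = (\<lambda>i. if i \<in> J then c i *\<^sub>R h i else h i)"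
  have "(\<lambda>i. if i \<in> insert k J then c i *\<^sub>R h i else h i) = h'(k := c k *\<^sub>R h' k)"
    using insert.hyps by (auto simp: h'_def)
  then have "\<gamma> (\<lambda>i. if i \<in> insert k J then c i *\<^sub>R h i else h i) = c k * \<gamma> h'"
    by (simp add: alternating_multilinearD(3)[OF \<gamma>])
  then show ?case using insert by (simp add: h'_def)
qed simp

text \<open>It suffices to find some factor \<open>k\<close> that depends on \<open>f\<close> only: then \<open>k\<close> is the determinant, as one
sees by taking the determinant of the rows for \<open>\<gamma>\<close>. The factors of a composition multiply, and for
elementary maps the factor is read off from the axioms of an alternating form.\<close>

lemma alternating_multilinear_linear_image:
  fixes f :: "real ^ 'n \<Rightarrow> real ^ 'n"
  assumes f: "linear f" and \<gamma>: "alternating_multilinear \<gamma>"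
  shows "\<gamma> (\<lambda>i. f (axis i 1)) = det (matrix f) * \<gamma> (\<lambda>i. axis i 1)"
proof -
  have "\<exists>k. \<forall>\<gamma>. alternating_multilinear \<gamma> \<longrightarrow> \<gamma> (\<lambda>i. f (axis i 1)) = k * \<gamma> (\<lambda>i. axis i (1::real))"
  proof (induction rule: induct_linear_elementary[OF f, case_names comp zeroes const swap idplus])
    case (comp f g)
    then obtain k k' where k: "\<And>\<gamma>. alternating_multilinear \<gamma> \<Longrightarrow> \<gamma> (\<lambda>i. f (axis i 1)) = k * \<gamma> (\<lambda>i. axis i 1)"
      "\<And>\<gamma>. alternating_multilinear \<gamma> \<Longrightarrow> \<gamma> (\<lambda>i. g (axis i 1)) = k' * \<gamma> (\<lambda>i. axis i 1)" by blast
    have "\<gamma> (\<lambda>i. (f \<circ> g) (axis i 1)) = k' * k * \<gamma> (\<lambda>i. axis i 1)" if "alternating_multilinear \<gamma>" for \<gamma>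
      using k(2)[OF alternating_multilinear_compose[OF that comp(1)]] k(1)[OF that] by simp
    then show ?case by blast
  next
    case (zeroes f i)
    have "\<not> surj f"
    proof
      assume "surj f"
      then obtain x where "f x = axis i 1" by (metis surjD)
      then show False using zeroes(2)[of x] by (simp add: axis_def)
    qed
    then have "\<not> inj f" using zeroes(1) linear_injective_imp_surjective by blast
    then obtain v where "f v = 0" "v \<noteq> 0" using linear_injective_0[OF zeroes(1)] by blast
    then show ?case using alternating_multilinear_dependent[OF _ zeroes(1)] by (intro exI[of _ 0]) auto
  next
    case (const c)
    have "(\<lambda>i. \<chi> j. c j * axis i 1 $ j) = (\<lambda>i. if i \<in> UNIV then c i *\<^sub>R axis i 1 else axis i (1::real))"
      by (auto simp: vec_eq_iff axis_def)
    then show ?case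
      using alternating_multilinear_scale[of _ UNIV c "\<lambda>i. axis i 1"] by (intro exI[of _ "\<Prod>i\<in>UNIV. c i"]) auto
  next
    case (swap m n)
    define e :: "'n \<Rightarrow> real ^ 'n" where "e = (\<lambda>i. axis i 1)"
    have "(\<lambda>i. \<chi> j. axis i (1::real) $ Transposition.transpose m n j) = e(m := e n, n := e m)"
      by (auto simp: vec_eq_iff axis_def e_def Transposition.transpose_def fun_eq_iff)
    then show ?case
      using alternating_multilinear_swap[OF _ swap, of _ e] by (intro exI[of _ "- 1"]) (auto simp: e_def)
  next
    case (idplus m n)
    define e :: "'n \<Rightarrow> real ^ 'n" where "e = (\<lambda>i. axis i 1)"
    have "(\<lambda>i. \<chi> j. if j = m then axis i (1::real) $ m + axis i 1 $ n else axis i 1 $ j) = e(n := e n + e m)"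
      using idplus by (auto simp: vec_eq_iff axis_def e_def fun_eq_iff)
    moreover have "\<gamma> (e(n := e n + e m)) = \<gamma> e" if \<gamma>: "alternating_multilinear \<gamma>" for \<gamma>
      using alternating_multilinearD(2)[OF \<gamma>, of e n "e n" "e m"]
        alternating_multilinearD(5)[OF \<gamma>, of n m "e(n := e m)"] idplus by auto
    ultimately show ?case by (intro exI[of _ 1]) (auto simp: e_def)
  qed
  then obtain k where k: "\<And>\<gamma>. alternating_multilinear \<gamma> \<Longrightarrow> \<gamma> (\<lambda>i. f (axis i 1)) = k * \<gamma> (\<lambda>i. axis i (1::real))"
    by blast
  have "(\<chi> i. f (axis i 1)) = Finite_Cartesian_Product.transpose (matrix f)"
    by (simp add: vec_eq_iff transpose_def matrix_def)
  moreover have "(\<chi> i. axis i 1) = (mat 1 :: real ^ 'n ^ 'n)"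
    by (auto simp: vec_eq_iff mat_def axis_def)
  ultimately have "det (matrix f) = k"
    using k[OF alternating_multilinear_det] by simp
  then show ?thesis using k[OF \<gamma>] by simp
qed

section \<open>Recurrence of volume-preserving diffeomorphisms\<close>

definition vec_form :: "('m::metric_space, 'e::euclidean_space) chart set \<Rightarrow>
    ('m \<Rightarrow> ('m, 'e) tangent list \<Rightarrow> real) \<Rightarrow> ('m, 'e) chart \<Rightarrow> 'm \<Rightarrow>
    ('e basis_index \<Rightarrow> real ^ 'e basis_index) \<Rightarrow> real" where
  "vec_form A \<omega> c x h = coord_form A \<omega> c x (map (\<lambda>j. of_vec (h (Abs_basis_index j))) [0..<DIM('e)])"

text \<open>In coordinates \<open>\<omega>\<close> is this function times the standard volume form.\<close>

definition form_density :: "('m::metric_space, 'e::euclidean_space) chart set \<Rightarrow>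
    ('m \<Rightarrow> ('m, 'e) tangent list \<Rightarrow> real) \<Rightarrow> ('m, 'e) chart \<Rightarrow> 'm \<Rightarrow> real" where
  "form_density A \<omega> c x = vec_form A \<omega> c x (\<lambda>i. axis i 1)"

lemma Abs_basis_index_eq_iff:
  "j < DIM('e) \<Longrightarrow> Abs_basis_index j = i \<longleftrightarrow> j = Rep_basis_index (i :: 'e::euclidean_space basis_index)"
  using Abs_basis_index_inverse[of j, where ?'e = 'e] Rep_basis_index_inverse[of i] by auto

lemma Rep_basis_index_less: "Rep_basis_index (i :: 'e::euclidean_space basis_index) < DIM('e)"
  using Rep_basis_index[of i] by simp

lemma alternating_multilinear_vec_form:
  fixes A :: "('m::metric_space, 'e::euclidean_space) chart set"
  assumes A: "1 \<le> r" "Cr_atlas r A" and \<omega>: "alternating_on A x (\<omega> x)" and c: "c \<in> charts_at A x"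
  shows "alternating_multilinear (vec_form A \<omega> c x)"
proof -
  define cv where "cv v = coord_vector A c x (of_vec v)" for v :: "real ^ 'e basis_index"
  define vs where "vs h = map (\<lambda>j. cv (h (Abs_basis_index j))) [0..<DIM('e)]"
    for h :: "'e basis_index \<Rightarrow> real ^ 'e basis_index"
  have form: "vec_form A \<omega> c x h = \<omega> x (vs h)" for h
    by (simp add: vec_form_def coord_form_def vs_def cv_def o_def)
  have cv: "cv v \<in> tangent_space A x" for v
    unfolding cv_def by (rule coord_vector_in_tangent_space[OF A c])
  have vs: "length (vs h) = DIM('e)" "set (vs h) \<subseteq> tangent_space A x" for h
    using cv by (auto simp: vs_def)
  have nth: "vs h ! Rep_basis_index i = cv (h i)" for h i
    using Rep_basis_index_less[of i] by (simp add: vs_def Rep_basis_index_inverse)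
  have upd: "vs (h(i := v)) = (vs h)[Rep_basis_index i := cv v]" for h i v
    by (rule nth_equalityI) (auto simp: vs_def nth_list_update Abs_basis_index_eq_iff)
  have lin: "linear (chart_derivative id c c' x)" if "c' \<in> charts_at A x" for c'
    using that c differentiable_map_id[OF A] by (auto intro!: linear_chart_derivative simp: charts_at_def)
  have cv_lin: "cv (a *\<^sub>R u + b *\<^sub>R w) = (\<lambda>c'. a *\<^sub>R cv u c' + b *\<^sub>R cv w c')" for a b u w
    using lin by (auto simp: cv_def coord_vector_def transition_derivative linear_add linear_scale
        linear_add[OF linear_of_vec] linear_scale[OF linear_of_vec])
  have alt: "\<omega> x ((vs h)[i := (\<lambda>c. a *\<^sub>R cv u c + b *\<^sub>R cv w c)]) = a * \<omega> x ((vs h)[i := cv u]) + b * \<omega> x ((vs h)[i := cv w])"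
    if "i < DIM('e)" for h i a b u w
    using \<omega> vs[of h] cv that unfolding alternating_on_def by blast
  have distinct: "\<omega> x (vs h) = 0" if "\<not> distinct (vs h)" for h
    using \<omega> vs[of h] that unfolding alternating_on_def by blast
  have zero: "vec_form A \<omega> c x h = 0" if "i \<noteq> j" "h i = h j" for h i j
  proof -
    have "\<not> distinct (vs h)"
      using nth_eq_iff_index_eq[of "vs h" "Rep_basis_index i" "Rep_basis_index j"] that
        Rep_basis_index_less[of i] Rep_basis_index_less[of j] by (auto simp: vs(1) nth Rep_basis_index_inject)
    then show ?thesis unfolding form by (rule distinct)
  qed
  have multilinear: "vec_form A \<omega> c x (h(i := a *\<^sub>R u + b *\<^sub>R w)) =
      a * vec_form A \<omega> c x (h(i := u)) + b * vec_form A \<omega> c x (h(i := w))" for h i a b u w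
    unfolding form upd cv_lin by (rule alt[OF Rep_basis_index_less])
  show ?thesis
    unfolding alternating_multilinear_def by (intro conjI allI impI) (rule multilinear, rule zero)
qed

text \<open>A nonvanishing value of \<open>\<omega> x\<close> is a determinant times the value on the coordinate basis.\<close>

lemma density_nonzero:
  fixes A :: "('m::metric_space, 'e::euclidean_space) chart set"
  assumes A: "1 \<le> r" "Cr_atlas r A" and \<omega>: "volume_form r A \<omega>" and c: "c \<in> charts_at A x"
  shows "form_density A \<omega> c x \<noteq> 0"
proof -
  have alt: "alternating_multilinear (vec_form A \<omega> c x)"
    using \<omega> by (intro alternating_multilinear_vec_form[OF A _ c]) (simp add: volume_form_def)
  obtain vs where vs: "length vs = DIM('e)" "set vs \<subseteq> tangent_space A x" "\<omega> x vs \<noteq> 0"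
    using \<omega> unfolding volume_form_def by blast
  define h :: "'e basis_index \<Rightarrow> real ^ 'e basis_index" where "h i = to_vec ((vs ! Rep_basis_index i) c)" for i
  have "map (\<lambda>j. coord_vector A c x (of_vec (h (Abs_basis_index j)))) [0..<DIM('e)] = vs"
  proof (rule nth_equalityI)
    fix j assume "j < length (map (\<lambda>j. coord_vector A c x (of_vec (h (Abs_basis_index j)))) [0..<DIM('e)])"
    then have j: "j < DIM('e)" by simp
    then have "vs ! j \<in> tangent_space A x" using vs by (metis nth_mem subsetD)
    then show "map (\<lambda>j. coord_vector A c x (of_vec (h (Abs_basis_index j)))) [0..<DIM('e)] ! j = vs ! j"
      using j c by (simp add: h_def Abs_basis_index_inverse coord_vector_of_tangent)
  qed (simp add: vs)
  then have "vec_form A \<omega> c x h \<noteq> 0" using vs(3) by (simp add: vec_form_def coord_form_def o_def)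
  moreover have "vec_form A \<omega> c x h = det (matrix (\<lambda>v. \<Sum>i\<in>UNIV. v $ i *\<^sub>R h i)) * form_density A \<omega> c x"
  proof -
    have "(\<Sum>k\<in>UNIV. axis i 1 $ k *\<^sub>R h k) = h i" for i
      by (simp add: axis_def if_distrib[of "\<lambda>a. a *\<^sub>R _"] cong: if_cong)
    moreover have "linear (\<lambda>v :: real ^ 'e basis_index. \<Sum>i\<in>UNIV. v $ i *\<^sub>R h i)"
      by (auto simp: linear_iff scaleR_add_left sum.distrib scaleR_sum_right)
    ultimately show ?thesis
      unfolding form_density_def using alternating_multilinear_linear_image[OF _ alt] by fastforce
  qed
  ultimately show ?thesis by auto
qed

lemma continuous_on_density:
  fixes A :: "('m::metric_space, 'e::euclidean_space) chart set"
  assumes A: "Cr_atlas r A" and \<omega>: "volume_form r A \<omega>" and c: "c \<in> A"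
  shows "continuous_on (fst c) (form_density A \<omega> c)"
proof -
  have chart: "is_chart c" using A c by (simp add: Cr_atlas_def)
  define bs where "bs = map (\<lambda>j. of_vec (axis (Abs_basis_index j :: 'e basis_index) 1)) [0..<DIM('e)]"
  define \<rho> where "\<rho> y = \<omega> (chart_inv c y) (map (coord_vector A c (chart_inv c y)) bs)" for y
  have "length bs = DIM('e)" by (simp add: bs_def)
  then have "Cr_on (r - 1) (snd c ` fst c) \<rho>"
    using \<omega> c unfolding volume_form_def \<rho>_def[abs_def] by blast
  then have "Ck_on 0 (snd c ` fst c) \<rho>" unfolding Cr_on_def by (metis zero_enat_def zero_le)
  then have "continuous_on (snd c ` fst c) \<rho>" by simp
  moreover have "continuous_on (fst c) (snd c)" using chart by (simp add: is_chart_def homeomorphism_def)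
  ultimately have "continuous_on (fst c) (\<lambda>x. \<rho> (snd c x))" by (auto intro: continuous_on_compose2)
  then show ?thesis
    by (rule continuous_on_eq) (simp add: \<rho>_def form_density_def vec_form_def coord_form_def bs_def chart_inv_left[OF chart])
qed

text \<open>An alternating form in top degree is multiplied by the determinant of a linear map, and \<open>f ^^ n\<close>
preserves \<open>\<omega>\<close>; so the Jacobian determinant in charts is a quotient of densities. It can therefore be bounded
uniformly in \<open>n\<close>.\<close>

lemma jacobian_funpow:
  fixes A :: "('m::metric_space, 'e::euclidean_space) chart set"
  assumes A: "1 \<le> r" "Cr_atlas r A" and \<omega>: "volume_form r A \<omega>"
    and f: "differentiable_map A f" "preserves_form A f \<omega>"
    and c: "c \<in> charts_at A x" "c' \<in> charts_at A ((f ^^ n) x)"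
  shows "det (matrix (to_vec \<circ> chart_derivative (f ^^ n) c c' x \<circ> of_vec)) * form_density A \<omega> c' ((f ^^ n) x) = form_density A \<omega> c x"
proof -
  have alt: "alternating_multilinear (vec_form A \<omega> c' ((f ^^ n) x))"
    using \<omega> by (intro alternating_multilinear_vec_form[OF A _ c(2)]) (simp add: volume_form_def)
  define D where "D = chart_derivative (f ^^ n) c c' x"
  define bs where "bs = map (\<lambda>j. of_vec (axis (Abs_basis_index j :: 'e basis_index) 1)) [0..<DIM('e)]"
  have "linear D" unfolding D_def
    by (rule linear_chart_derivative[OF differentiable_map_funpow[OF A f(1)]]) (use c in \<open>auto simp: charts_at_def\<close>)
  then have lin: "linear (to_vec \<circ> D \<circ> of_vec)"
    by (intro linear_compose linear_to_vec linear_of_vec)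
  have "vec_form A \<omega> c' ((f ^^ n) x) (\<lambda>i. (to_vec \<circ> D \<circ> of_vec) (axis i 1)) = coord_form A \<omega> c' ((f ^^ n) x) (map D bs)"
    by (simp add: vec_form_def bs_def o_def)
  also have "\<dots> = coord_form A \<omega> c x bs"
    unfolding D_def by (rule coord_form_funpow[OF A f c]) (simp add: bs_def)
  also have "\<dots> = form_density A \<omega> c x" by (simp add: form_density_def vec_form_def bs_def)
  finally show ?thesis
    using alternating_multilinear_linear_image[OF lin alt] by (simp add: form_density_def D_def)
qed

text \<open>The chart with values in \<open>real ^ 'e basis_index\<close>, where volumes are measured.\<close>

definition vec_chart :: "('m, 'e::euclidean_space) chart \<Rightarrow> 'm \<Rightarrow> real ^ 'e basis_index" where
  "vec_chart c x = to_vec (snd c x)"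

lemma continuous_on_to_vec: "continuous_on S to_vec" and continuous_on_of_vec: "continuous_on S' of_vec"
  using linear_to_vec linear_of_vec by (auto intro: linear_continuous_on simp: linear_conv_bounded_linear)

text \<open>A map cannot increase volume by more than the largest absolute value of its Jacobian determinant. The bound \<open>B\<close> is
imposed on the densities, because it is there that it can be verified for all \<open>n\<close> at once.\<close>

lemma measure_chart_image_le:
  fixes A :: "('m::metric_space, 'e::euclidean_space) chart set"
  assumes A: "1 \<le> r" "Cr_atlas r A" and \<omega>: "volume_form r A \<omega>"
    and f: "differentiable_map A f" "preserves_form A f \<omega>"
    and c: "c \<in> A" "c' \<in> A" and S: "S \<subseteq> fst c" "(f ^^ n) ` S \<subseteq> fst c'"
    and meas: "vec_chart c ` S \<in> lmeasurable"
    and B: "\<And>x. x \<in> S \<Longrightarrow> \<bar>form_density A \<omega> c x\<bar> \<le> B * \<bar>form_density A \<omega> c' ((f ^^ n) x)\<bar>"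
  shows "vec_chart c' ` (f ^^ n) ` S \<in> lmeasurable"
    and "measure lebesgue (vec_chart c' ` (f ^^ n) ` S) \<le> B * measure lebesgue (vec_chart c ` S)"
proof -
  have chart: "is_chart c" using A c by (simp add: Cr_atlas_def)
  define pt where "pt y = chart_inv c (of_vec y)" for y
  have pt: "pt (vec_chart c x) = x" if "x \<in> S" for x
    using that S(1) chart_inv_left[OF chart] by (auto simp: pt_def vec_chart_def)
  define h where "h = to_vec \<circ> (snd c' \<circ> (f ^^ n) \<circ> chart_inv c) \<circ> of_vec"
  define h' where "h' y = to_vec \<circ> chart_derivative (f ^^ n) c c' (pt y) \<circ> of_vec" for y
  have image: "h ` vec_chart c ` S = vec_chart c' ` (f ^^ n) ` S"
    using pt by (force simp: h_def vec_chart_def pt_def image_image)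
  have deriv: "(h has_derivative h' y) (at y within vec_chart c ` S)" if y: "y \<in> vec_chart c ` S" for y
  proof -
    obtain x where x: "x \<in> S" "y = vec_chart c x" using y by auto
    have "((snd c' \<circ> (f ^^ n) \<circ> chart_inv c) has_derivative chart_derivative (f ^^ n) c c' x) (at (of_vec y))"
      using chart_derivative[OF differentiable_map_funpow[OF A f(1)] c, of x n] x S by (auto simp: vec_chart_def)
    moreover have "(of_vec has_derivative of_vec) (at y)" "\<And>z. (to_vec has_derivative to_vec) (at z)"
      using linear_of_vec linear_to_vec
      by (auto simp: linear_conv_bounded_linear intro: bounded_linear_imp_has_derivative)
    ultimately have "(h has_derivative h' y) (at y)"
      unfolding h_def h'_def using pt[OF x(1)] x(2) by (intro diff_chain_at) (simp_all add: o_def)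
    then show ?thesis by (rule has_derivative_at_withinI)
  qed
  have det: "\<bar>det (matrix (h' y))\<bar> = \<bar>form_density A \<omega> c (pt y)\<bar> / \<bar>form_density A \<omega> c' ((f ^^ n) (pt y))\<bar>"
    and det_le: "\<bar>det (matrix (h' y))\<bar> \<le> B" if y: "y \<in> vec_chart c ` S" for y
  proof -
    obtain x where x: "x \<in> S" "y = vec_chart c x" using y by auto
    have charts: "c \<in> charts_at A x" "c' \<in> charts_at A ((f ^^ n) x)" using x S c by (auto simp: charts_at_def)
    note nz = density_nonzero[OF A \<omega> charts(2)]
    have "\<bar>det (matrix (h' y))\<bar> * \<bar>form_density A \<omega> c' ((f ^^ n) x)\<bar> = \<bar>form_density A \<omega> c x\<bar>"
      using jacobian_funpow[OF A \<omega> f charts] x(2) pt[OF x(1)] unfolding h'_def by (metis abs_mult)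
    then show *: "\<bar>det (matrix (h' y))\<bar> = \<bar>form_density A \<omega> c (pt y)\<bar> / \<bar>form_density A \<omega> c' ((f ^^ n) (pt y))\<bar>"
      using nz x(2) pt[OF x(1)] by (simp add: field_simps)
    show "\<bar>det (matrix (h' y))\<bar> \<le> B"
      unfolding * using B[OF x(1)] nz x(2) pt[OF x(1)] by (simp add: divide_le_eq)
  qed
  have cont_pt: "continuous_on (vec_chart c ` S) pt"
    unfolding pt_def
    by (rule continuous_on_compose2[of "snd c ` fst c" "chart_inv c"])
      (use chart S(1) in \<open>auto simp: vec_chart_def is_chart_def homeomorphism_def intro: continuous_on_of_vec\<close>)
  have "continuous_on (vec_chart c ` S) (\<lambda>y. \<bar>form_density A \<omega> c (pt y)\<bar> / \<bar>form_density A \<omega> c' ((f ^^ n) (pt y))\<bar>)"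
  proof (intro continuous_on_divide continuous_on_rabs)
    show "continuous_on (vec_chart c ` S) (\<lambda>y. form_density A \<omega> c (pt y))"
      by (rule continuous_on_compose2[OF continuous_on_density[OF A(2) \<omega> c(1)] cont_pt]) (use S pt in auto)
    have "continuous_on (vec_chart c ` S) (\<lambda>y. (f ^^ n) (pt y))"
      using f(1) cont_pt by (auto simp: differentiable_map_def intro: continuous_on_compose2[OF continuous_on_funpow])
    then show "continuous_on (vec_chart c ` S) (\<lambda>y. form_density A \<omega> c' ((f ^^ n) (pt y)))"
      by (rule continuous_on_compose2[OF continuous_on_density[OF A(2) \<omega> c(2)]]) (use S pt in auto)
    show "\<forall>y\<in>vec_chart c ` S. \<bar>form_density A \<omega> c' ((f ^^ n) (pt y))\<bar> \<noteq> 0"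
      using density_nonzero[OF A \<omega>, of c'] S c pt by (auto simp: charts_at_def)
  qed
  then have "continuous_on (vec_chart c ` S) (\<lambda>y. \<bar>det (matrix (h' y))\<bar>)"
    by (rule continuous_on_eq) (simp add: det)
  then have int: "(\<lambda>y. \<bar>det (matrix (h' y))\<bar>) integrable_on vec_chart c ` S"
  proof (rule measurable_bounded_by_integrable_imp_integrable[OF continuous_imp_measurable_on_sets_lebesgue])
    show "vec_chart c ` S \<in> sets lebesgue" "vec_chart c ` S \<in> sets lebesgue" using meas by (simp_all add: fmeasurableD)
    show "(\<lambda>y. B) integrable_on vec_chart c ` S" using meas by (rule integrable_on_const)
    show "norm \<bar>det (matrix (h' y))\<bar> \<le> B" if "y \<in> vec_chart c ` S" for y using det_le[OF that] by simp
  qed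
  show "vec_chart c' ` (f ^^ n) ` S \<in> lmeasurable"
    unfolding image[symmetric]
    by (rule measurable_bounded_differentiable_image[OF meas deriv int det_le])
  show "measure lebesgue (vec_chart c' ` (f ^^ n) ` S) \<le> B * measure lebesgue (vec_chart c ` S)"
    unfolding image[symmetric]
    by (rule measure_bounded_differentiable_image[OF meas deriv int det_le])
qed


lemma compact_chart_cover:
  fixes A :: "('m::metric_space, 'e::euclidean_space) chart set"
  assumes A: "Cr_atlas r A" and M: "compact (UNIV :: 'm set)"
  obtains J where "finite J" "\<forall>(c, K)\<in>J. c \<in> A \<and> compact K \<and> K \<subseteq> fst c" "(\<Union>(c, K)\<in>J. K) = UNIV"
proof -
  have "\<exists>c e. c \<in> A \<and> e > 0 \<and> cball x e \<subseteq> fst c" for x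
  proof -
    obtain c where c: "c \<in> A" "x \<in> fst c" "is_chart c" using atlas_chart_at[OF A] .
    then have "open (fst c)" by (simp add: is_chart_def)
    then show ?thesis using c open_contains_cball by blast
  qed
  then obtain c e where ce: "\<And>x. c x \<in> A" "\<And>x. e x > 0" "\<And>x. cball x (e x) \<subseteq> fst (c x)" by metis
  have "x \<in> ball x (e x)" for x using ce(2) by simp
  then have "UNIV \<subseteq> (\<Union>x\<in>UNIV. ball x (e x))" by blast
  have "\<exists>X. finite X \<and> UNIV \<subseteq> (\<Union>x\<in>X. ball x (e x))"
  proof (rule compactE_image[OF M])
    show "open (ball x (e x))" for x by (rule open_ball)
    show "UNIV \<subseteq> (\<Union>x\<in>UNIV. ball x (e x))" by fact
    fix X assume "finite X" "UNIV \<subseteq> (\<Union>x\<in>X. ball x (e x))"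
    then show ?thesis by (intro exI[of _ X] conjI)
  qed
  then obtain X where X: "finite X" "UNIV \<subseteq> (\<Union>x\<in>X. ball x (e x))" by (elim exE conjE)
  show thesis
  proof (rule that[of "(\<lambda>x. (c x, cball x (e x))) ` X"])
    show "(\<Union>(c, K)\<in>(\<lambda>x. (c x, cball x (e x))) ` X. K) = UNIV"
    proof -
      have "(\<Union>x\<in>X. ball x (e x)) \<subseteq> (\<Union>x\<in>X. cball x (e x))"
        by (rule UN_mono[OF order_refl ball_subset_cball])
      then have "(\<Union>x\<in>X. cball x (e x)) = UNIV" using X(2) by (meson UNIV_I subset_antisym subset_trans subset_UNIV)
      then show ?thesis by simp
    qed
    show "\<forall>(c', K)\<in>(\<lambda>x. (c x, cball x (e x))) ` X. c' \<in> A \<and> compact K \<and> K \<subseteq> fst c'"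
      using ce(1,3) compact_Int_closed[OF M closed_cball] by auto
  qed (use X in simp)
qed

lemma continuous_on_vec_chart: "is_chart c \<Longrightarrow> continuous_on (fst c) (vec_chart c)"
  unfolding vec_chart_def[abs_def]
  by (rule continuous_on_compose2[OF continuous_on_to_vec[of UNIV]]) (auto simp: is_chart_def homeomorphism_def)

lemma inj_on_vec_chart: "is_chart c \<Longrightarrow> inj_on (vec_chart c) (fst c)"
  by (rule inj_on_inverseI[of _ "\<lambda>y. chart_inv c (of_vec y)"]) (simp add: vec_chart_def chart_inv_left)

lemma open_vec_chart_image:
  assumes "is_chart c" "open U" "U \<subseteq> fst c"
  shows "open (vec_chart c ` U)"
proof -
  have "open (snd c ` U)" using open_chart_preimage[OF assms(1,2)] assms(3) by (simp add: Int_absorb1)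
  moreover have "vec_chart c ` U = of_vec -` (snd c ` U)"
  proof safe
    fix v x assume "of_vec v = snd c x" "x \<in> U"
    then have "v = vec_chart c x" by (metis to_vec_of_vec vec_chart_def)
    then show "v \<in> vec_chart c ` U" using \<open>x \<in> U\<close> by blast
  qed (auto simp: vec_chart_def)
  ultimately show ?thesis by (simp add: open_vimage continuous_on_of_vec)
qed

text \<open>This is Poincare recurrence for open sets. If \<open>W\<close> never returns, the preimages \<open>P n\<close> of a small ball \<open>U\<close> in \<open>W\<close> are
pairwise disjoint. Cover \<open>M\<close> by finitely many compact pieces \<open>K\<close> of charts. The densities of \<open>\<omega>\<close> are
bounded on the pieces and bounded away from \<open>0\<close> near \<open>U\<close>, so \<open>f ^^ (N * n)\<close>, which maps \<open>P n\<close> onto \<open>U\<close>,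
increases chart volumes by at most a factor \<open>B\<close> independent of \<open>n\<close>. Thus all \<open>P n\<close> have a
volume of at least \<open>vol U / B\<close>, whereas their volumes add up to at most the finite volume of the pieces.\<close>

lemma no_wandering_open_set:
  fixes A :: "('m::metric_space, 'e::euclidean_space) chart set"
  assumes A: "1 \<le> r" "Cr_atlas r A" and M: "compact (UNIV :: 'm set)" and \<omega>: "volume_form r A \<omega>"
    and f: "bij f" "differentiable_map A f" "preserves_form A f \<omega>"
    and N: "N \<ge> 1" and W: "open W" "W \<noteq> {}"
  shows "\<exists>n\<ge>1. (f ^^ (N * n)) ` W \<inter> W \<noteq> {}"
proof (rule ccontr)
  assume "\<not> ?thesis"
  then have wandering: "(f ^^ (N * n)) ` W \<inter> W = {}" if "n \<ge> 1" for n using that by blast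
  have cont: "continuous_on UNIV (f ^^ n)" for n
    using f(2) by (simp add: differentiable_map_def continuous_on_funpow)
  obtain x0 where x0: "x0 \<in> W" using W(2) by blast
  obtain c0 where c0: "c0 \<in> A" "x0 \<in> fst c0" "is_chart c0" using atlas_chart_at[OF A(2)] .
  then have "open (W \<inter> fst c0)" using W(1) by (auto simp: is_chart_def)
  then obtain e where e: "e > 0" "cball x0 e \<subseteq> W \<inter> fst c0"
    using x0 c0(2) open_contains_cball by blast
  define U where "U = ball x0 e"
  define K0 where "K0 = cball x0 e"
  have U: "open U" "x0 \<in> U" "U \<subseteq> K0" "U \<subseteq> W" "K0 \<subseteq> fst c0"
    using e by (auto simp: U_def K0_def)
  have K0: "compact K0" using compact_Int_closed[OF M, of K0] by (simp add: K0_def)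
  obtain J where "finite J" "\<forall>(c, K)\<in>J. c \<in> A \<and> compact K \<and> K \<subseteq> fst c" "(\<Union>(c, K)\<in>J. K) = UNIV"
    using compact_chart_cover[OF A(2) M] .
  then have J: "finite J" "\<And>c K. (c, K) \<in> J \<Longrightarrow> c \<in> A \<and> compact K \<and> K \<subseteq> fst c" "(\<Union>(c, K)\<in>J. K) = UNIV"
    by auto
  have chart: "is_chart c" if "(c, K) \<in> J" for c K using J(2)[OF that] A(2) by (simp add: Cr_atlas_def)
  obtain b0 where b0: "b0 > 0" "\<And>x. x \<in> K0 \<Longrightarrow> b0 \<le> \<bar>form_density A \<omega> c0 x\<bar>"
  proof -
    have "continuous_on K0 (\<lambda>x. \<bar>form_density A \<omega> c0 x\<bar>)"
      using continuous_on_density[OF A(2) \<omega> c0(1)] U(5) by (intro continuous_on_rabs) (rule continuous_on_subset)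
    moreover have "K0 \<noteq> {}" using U by auto
    ultimately have "\<exists>y\<in>K0. \<forall>x\<in>K0. \<bar>form_density A \<omega> c0 y\<bar> \<le> \<bar>form_density A \<omega> c0 x\<bar>"
      by (intro continuous_attains_inf K0)
    then obtain y where y: "y \<in> K0" "\<And>x. x \<in> K0 \<Longrightarrow> \<bar>form_density A \<omega> c0 y\<bar> \<le> \<bar>form_density A \<omega> c0 x\<bar>"
      by blast
    have "form_density A \<omega> c0 y \<noteq> 0"
      using density_nonzero[OF A \<omega>, of c0 y] y(1) U(5) c0(1) by (auto simp: charts_at_def)
    then show thesis using that[of "\<bar>form_density A \<omega> c0 y\<bar>"] y by auto
  qed
  have "\<exists>b. \<forall>x\<in>K. \<bar>form_density A \<omega> c x\<bar> \<le> b" if "(c, K) \<in> J" for c K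
  proof -
    have "continuous_on K (form_density A \<omega> c)"
      using continuous_on_density[OF A(2) \<omega>, of c] J(2)[OF that] by (meson continuous_on_subset)
    then have "compact (form_density A \<omega> c ` K)" using J(2)[OF that] by (intro compact_continuous_image) auto
    then have "bounded (form_density A \<omega> c ` K)" by (rule compact_imp_bounded)
    then show ?thesis by (auto simp: bounded_iff)
  qed
  then obtain b where b: "\<And>c K x. (c, K) \<in> J \<Longrightarrow> x \<in> K \<Longrightarrow> \<bar>form_density A \<omega> c x\<bar> \<le> b c K" by metis
  \<comment> \<open>\<open>b1\<close> bounds the densities on all pieces, and \<open>b0\<close> bounds from below the one of the chart \<open>c0\<close>\<close>
  define b1 where "b1 = (\<Sum>(c, K)\<in>J. \<bar>b c K\<bar>)"
  have b1: "\<bar>form_density A \<omega> c x\<bar> \<le> b1" if "(c, K) \<in> J" "x \<in> K" for c K x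
  proof -
    have "\<bar>b c K\<bar> \<le> b1" unfolding b1_def
      using member_le_sum[OF that(1), of "\<lambda>(c, K). \<bar>b c K\<bar>"] J(1) by auto
    then show ?thesis using b[OF that] by linarith
  qed
  define B where "B = b1 / b0"
  define P where "P n = (f ^^ (N * n)) -` U" for n
  have P_open: "open (P n)" for n unfolding P_def using U(1) cont by (rule open_vimage)
  have P_disjoint: "P m \<inter> P n = {}" if "m < n" for m n
  proof -
    have False if z: "z \<in> P m" "z \<in> P n" for z
    proof -
      have "N * n = N * (n - m) + N * m" using \<open>m < n\<close> by (simp add: diff_mult_distrib2)
      then have "(f ^^ (N * n)) z = (f ^^ (N * (n - m))) ((f ^^ (N * m)) z)" by (simp add: funpow_add)
      moreover have "(f ^^ (N * m)) z \<in> W" "(f ^^ (N * n)) z \<in> W" using z U(4) by (auto simp: P_def)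
      moreover have "(f ^^ (N * (n - m))) ` W \<inter> W = {}" using \<open>m < n\<close> by (intro wandering) simp
      ultimately show False by (metis disjoint_iff imageI)
    qed
    then show ?thesis by blast
  qed
  define \<mu> where "\<mu> c S = measure lebesgue (vec_chart c ` S)" for c :: "('m, 'e) chart" and S
  have meas: "vec_chart c ` (P n \<inter> K) \<in> lmeasurable" "vec_chart c ` K \<in> lmeasurable" if "(c, K) \<in> J" for c K n
  proof -
    have K: "compact K" "compact (K - P n)" "K \<subseteq> fst c" using J(2)[OF that] P_open[of n] by (auto intro: compact_diff)
    have comp: "vec_chart c ` S \<in> lmeasurable" if "compact S" "S \<subseteq> fst c" for S
      using that continuous_on_vec_chart[OF chart[OF \<open>(c, K) \<in> J\<close>]]
      by (intro lmeasurable_compact compact_continuous_image) (auto intro: continuous_on_subset)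
    have "vec_chart c ` (P n \<inter> K) = vec_chart c ` K - vec_chart c ` (K - P n)"
      using inj_on_vec_chart[OF chart[OF that]] K(3) by (auto simp: inj_on_def)
    then show "vec_chart c ` (P n \<inter> K) \<in> lmeasurable"
      using comp[of K] comp[of "K - P n"] K by (auto intro!: fmeasurable_Diff fmeasurableD)
    show "vec_chart c ` K \<in> lmeasurable" using comp K by blast
  qed
  have step: "vec_chart c0 ` (f ^^ (N * n)) ` (P n \<inter> K) \<in> lmeasurable"
    "\<mu> c0 ((f ^^ (N * n)) ` (P n \<inter> K)) \<le> B * \<mu> c (P n \<inter> K)" if cK: "(c, K) \<in> J" for c K n
  proof -
    have bound: "\<bar>form_density A \<omega> c x\<bar> \<le> B * \<bar>form_density A \<omega> c0 ((f ^^ (N * n)) x)\<bar>" if "x \<in> P n \<inter> K" for x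
    proof -
      have "\<bar>form_density A \<omega> c x\<bar> \<le> b1" using b1[OF cK] that by simp
      moreover have "b0 \<le> \<bar>form_density A \<omega> c0 ((f ^^ (N * n)) x)\<bar>" using b0(2) that U(3) by (auto simp: P_def)
      ultimately have "b1 * b0 \<le> b1 * \<bar>form_density A \<omega> c0 ((f ^^ (N * n)) x)\<bar>" by (intro mult_left_mono) auto
      then have "b1 \<le> B * \<bar>form_density A \<omega> c0 ((f ^^ (N * n)) x)\<bar>"
        using b0(1) by (simp add: B_def field_simps)
      then show ?thesis using \<open>_ \<le> b1\<close> by linarith
    qed
    have sub: "P n \<inter> K \<subseteq> fst c" "(f ^^ (N * n)) ` (P n \<inter> K) \<subseteq> fst c0"
      using J(2)[OF cK] U by (auto simp: P_def)
    have "c \<in> A" using J(2)[OF cK] by simp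
    note image = measure_chart_image_le[OF A \<omega> f(2,3) \<open>c \<in> A\<close> c0(1) sub meas(1)[OF cK] bound]
    show "vec_chart c0 ` (f ^^ (N * n)) ` (P n \<inter> K) \<in> lmeasurable" by (rule image(1))
    show "\<mu> c0 ((f ^^ (N * n)) ` (P n \<inter> K)) \<le> B * \<mu> c (P n \<inter> K)" unfolding \<mu>_def by (rule image(2))
  qed
  have pos: "\<mu> c0 U > 0"
  proof -
    have op: "open (vec_chart c0 ` U)" using U by (intro open_vec_chart_image c0) auto
    have "compact (vec_chart c0 ` K0)"
      using continuous_on_vec_chart[OF c0(3)] U(5) K0 by (intro compact_continuous_image) (auto intro: continuous_on_subset)
    then have "bounded (vec_chart c0 ` U)" using U(3) by (meson bounded_subset compact_imp_bounded image_mono)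
    then have "vec_chart c0 ` U \<in> lmeasurable" using op by (rule lmeasurable_open)
    moreover have "\<not> negligible (vec_chart c0 ` U)" using op U(2) by (intro open_not_negligible) auto
    ultimately have "\<mu> c0 U \<noteq> 0" by (simp add: negligible_iff_measure \<mu>_def)
    then show ?thesis by (simp add: \<mu>_def zero_less_measure_iff)
  qed
  define V where "V = (\<Sum>(c, K)\<in>J. \<mu> c K)"
  \<comment> \<open>the iterate maps \<open>P n\<close> onto \<open>U\<close>\<close>
  have lower: "\<mu> c0 U \<le> B * (\<Sum>(c, K)\<in>J. \<mu> c (P n \<inter> K))" for n
  proof -
    have "U = (\<Union>(c, K)\<in>J. (f ^^ (N * n)) ` (P n \<inter> K))"
    proof safe
      fix u assume "u \<in> U"
      obtain z where z: "u = (f ^^ (N * n)) z" using bij_is_surj[OF bij_fn[OF f(1)]] by (rule surjE)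
      have "z \<in> (\<Union>(c, K)\<in>J. K)" using J(3) by simp
      then obtain c K where "(c, K) \<in> J" "z \<in> K" by auto
      then show "u \<in> (\<Union>(c, K)\<in>J. (f ^^ (N * n)) ` (P n \<inter> K))" using z \<open>u \<in> U\<close> by (auto simp: P_def)
    qed (auto simp: P_def)
    then have "vec_chart c0 ` U = vec_chart c0 ` (\<Union>s\<in>J. (f ^^ (N * n)) ` (P n \<inter> snd s))"
      by (simp only: case_prod_unfold)
    then have "vec_chart c0 ` U = (\<Union>s\<in>J. vec_chart c0 ` (f ^^ (N * n)) ` (P n \<inter> snd s))"
      by (simp only: image_UN)
    then have "\<mu> c0 U \<le> (\<Sum>s\<in>J. \<mu> c0 ((f ^^ (N * n)) ` (P n \<inter> snd s)))"
      unfolding \<mu>_def using step(1)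
      by (simp only:) (rule measure_UNION_le[OF J(1)], metis fmeasurableD prod.collapse)
    also have "\<dots> \<le> (\<Sum>s\<in>J. B * \<mu> (fst s) (P n \<inter> snd s))"
      using step(2) by (intro sum_mono) (metis prod.collapse)
    finally show ?thesis by (simp add: sum_distrib_left case_prod_unfold)
  qed
  \<comment> \<open>the sets \<open>P n\<close> are disjoint\<close>
  have upper: "(\<Sum>n<m. \<mu> c (P n \<inter> K)) \<le> \<mu> c K" if cK: "(c, K) \<in> J" for c K m
  proof -
    have "pairwise (\<lambda>i j. disjnt (vec_chart c ` (P i \<inter> K)) (vec_chart c ` (P j \<inter> K))) {..<m}"
    proof (rule pairwiseI)
      fix i j :: nat assume "i \<noteq> j"
      then have "P i \<inter> P j = {}" using P_disjoint[of i j] P_disjoint[of j i] by (cases "i < j") auto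
      then have "(P i \<inter> K) \<inter> (P j \<inter> K) = {}" by blast
      moreover have "vec_chart c ` ((P i \<inter> K) \<inter> (P j \<inter> K)) = vec_chart c ` (P i \<inter> K) \<inter> vec_chart c ` (P j \<inter> K)"
        using J(2)[OF cK] by (intro inj_on_image_Int[OF inj_on_vec_chart[OF chart[OF cK]]]) auto
      ultimately show "disjnt (vec_chart c ` (P i \<inter> K)) (vec_chart c ` (P j \<inter> K))"
        by (simp add: disjnt_def)
    qed
    then have "(\<Sum>n<m. \<mu> c (P n \<inter> K)) = measure lebesgue (\<Union>n<m. vec_chart c ` (P n \<inter> K))"
      unfolding \<mu>_def using meas(1)[OF cK] by (intro measure_UNION'[symmetric]) auto
    also have "\<dots> \<le> \<mu> c K"
      unfolding \<mu>_def using meas[OF cK]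
      by (intro measure_mono_fmeasurable) (auto intro!: sets.finite_UN fmeasurableD)
    finally show ?thesis .
  qed
  have "real m * \<mu> c0 U \<le> B * V" for m
  proof -
    have "0 < B * (\<Sum>(c, K)\<in>J. \<mu> c (P 0 \<inter> K))" using lower[of 0] pos by linarith
    moreover have "0 \<le> (\<Sum>(c, K)\<in>J. \<mu> c (P 0 \<inter> K))" by (intro sum_nonneg) (auto simp: \<mu>_def)
    ultimately have "B \<ge> 0" by (metis less_le_not_le linorder_le_cases mult_nonpos_nonneg)
    have "real m * \<mu> c0 U = (\<Sum>n<m. \<mu> c0 U)" by simp
    also have "\<dots> \<le> (\<Sum>n<m. B * (\<Sum>s\<in>J. \<mu> (fst s) (P n \<inter> snd s)))"
      using lower by (intro sum_mono) (simp add: case_prod_unfold)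
    also have "\<dots> = B * (\<Sum>s\<in>J. \<Sum>n<m. \<mu> (fst s) (P n \<inter> snd s))"
      by (subst sum.swap) (simp add: sum_distrib_left)
    also have "\<dots> \<le> B * V"
      unfolding V_def case_prod_unfold using upper \<open>B \<ge> 0\<close>
      by (intro mult_left_mono sum_mono) (metis prod.collapse)
    finally show ?thesis .
  qed
  moreover obtain m where "B * V < real m * \<mu> c0 U" using reals_Archimedean3[OF pos] by blast
  ultimately show False by (meson not_le)
qed

section \<open>Nonshadowability\<close>

theorem theorem5p2:
  fixes A :: "('m::metric_space, 'e::euclidean_space) chart set"
    and r :: enat
    and \<omega> :: "'m \<Rightarrow> ('m, 'e) tangent list \<Rightarrow> real"
    and f :: "'m \<Rightarrow> 'm"
    and p :: 'm
  assumes "1 \<le> r" and "Cr_atlas r A"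
    and "compact (UNIV :: 'm set)"
    and "volume_form r A \<omega>"
    and "C1_diffeomorphism A f"
    and "preserves_form A f \<omega>"
    and "hyperbolic_periodic_point A f p"
    and "\<exists>q \<in> unstable_manifold p f. recurrent f q"
    and "\<not> (\<exists>q. homoclinic_point p f q)"
  shows "nonshadowable f"
proof -
  note A = assms(1,2) and M = assms(3)
  have f: "bij f" "differentiable_map A f" "differentiable_map A (inv f)"
    using assms(5) C1_map_imp_differentiable_map[OF A(2)] by (auto simp: C1_diffeomorphism_def)
  have cont: "continuous_on UNIV f" "continuous_on UNIV (inv f)"
    using f by (auto simp: differentiable_map_def)
  obtain k where k: "k > 0" "(f ^^ k) p = p"
    and ev: "\<And>z. complex_eigenvalue (tangent_space A p) (differential A (f ^^ k) p) z \<Longrightarrow> cmod z \<noteq> 1"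
    using assms(7) by (auto simp: hyperbolic_periodic_point_def has_period_def)
  define g where "g = f ^^ k"
  have inv_g: "inv g = inv f ^^ k" using f(1) by (simp add: g_def inv_fn)
  have g: "bij g" "differentiable_map A g" "differentiable_map A (inv g)" "g p = p"
    using f k bij_fn[OF f(1), of k] differentiable_map_funpow[OF A] by (auto simp: g_def inv_fn)
  have cont_g: "continuous_on UNIV g" "continuous_on UNIV (inv g)"
    using g by (auto simp: differentiable_map_def)
  obtain e where e: "e > 0"
    and "\<forall>y. (\<forall>n. dist ((g ^^ n) y) p \<le> e) \<longrightarrow> (\<forall>n. dist ((inv g ^^ n) y) p \<le> e) \<longrightarrow> y = p"
    using hyperbolic_imp_isolated[OF A g] ev unfolding g_def by blast
  then have iso: "y = p" if "\<And>n. dist ((g ^^ n) y) p \<le> e" "\<And>n. dist ((inv g ^^ n) y) p \<le> e" for y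
    using that by blast
  have recurrence: "\<exists>n\<ge>1. (f ^^ (N * n)) ` W \<inter> W \<noteq> {}" if "N \<ge> 1" "open W" "W \<noteq> {}" for N W
    using no_wandering_open_set[OF A M assms(4) f(1,2) assms(6) that] .
  have "\<not> open {p}"
  proof
    assume "open {p}"
    obtain c where "c \<in> A" "p \<in> fst c" "is_chart c" using atlas_chart_at[OF A(2)] .
    then show False using open_chart_preimage[OF _ \<open>open {p}\<close>, of c] not_open_singleton[of "snd c p"] by simp
  qed
  have "\<not> (\<forall>e'. 0 < e' \<longrightarrow> e' \<le> e \<longrightarrow> (\<exists>d>0. \<forall>x n. dist x p < d \<longrightarrow> dist ((g ^^ n) x) p \<le> e'))"
  proof
    assume stable: "\<forall>e'. 0 < e' \<longrightarrow> e' \<le> e \<longrightarrow> (\<exists>d>0. \<forall>x n. dist x p < d \<longrightarrow> dist ((g ^^ n) x) p \<le> e')"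
    obtain N W where N: "N \<ge> 1" "open W" "W \<noteq> {}" and W: "\<And>n. n \<ge> 1 \<Longrightarrow> (g ^^ (N * n)) ` W \<inter> W = {}"
      by (rule stable_isolated_imp_wandering[OF M g(1) cont_g iso e \<open>\<not> open {p}\<close>]) (use stable in auto)
    have "g ^^ (N * n) = f ^^ (k * N * n)" for n by (simp add: g_def funpow_mult mult.assoc)
    then show False using recurrence[of "k * N" W] N W k(1) by fastforce
  qed
  then obtain e' where e': "0 < e'" "e' \<le> e"
    and unstable: "\<And>d. d > 0 \<Longrightarrow> \<exists>x n. dist x p < d \<and> dist ((g ^^ n) x) p > e'"
    by (meson not_le)
  obtain q where q: "q \<noteq> p" "(\<lambda>n. (inv g ^^ n) q) \<longlonglongrightarrow> p"
    by (rule unstable_isolated_imp_unstable_manifold[OF M g(1) cont_g g(4) iso e' unstable])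
  show ?thesis
    by (rule nonshadowable_if_isolated_recurrent_saddle[OF M f(1) cont k e _ q(1) _ recurrence assms(9)])
      (use iso q(2) in \<open>simp_all add: g_def inv_g[unfolded g_def]\<close>)
qed

end
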